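(* A constellation $[\mathbb{X},\mathbb{P}]$ (natural binary code labeling, bit probabilities $P_{C_k}(0)\in(0,1)$) is first-order optimal if and only if both $$\boldsymbol{\mu}=\sum_{i=0}^{M-1}P_i\boldsymbol{x}_i=\boldsymbol{0}$$ and $$\tilde{\boldsymbol{x}}_j=\boldsymbol{0}\quad\text{for all } j\notin\{0\}\cup\{1,2,4,\ldots,M/2\},$$ where $\tilde{\mathbb{X}}$ is the Hadamard transform of $\mathbb{X}$.
   Context: Let $m\ge1$, $M=2^m$, $N\ge1$. For $0\le i\le M-1$, $n_{i,k}\in\{0,1\}$ is the $k$-th bit of $i$ ($i=\sum_kn_{i,k}2^k$). A constellation $[\mathbb{X},\mathbb{P}]$ consists of an alphabet $\mathbb{X}$ with rows $\boldsymbol{x}_0,\ldots,\boldsymbol{x}_{M-1}\in\mathbb{R}^N$, symbol $\boldsymbol{x}_i$ labeled $(n_{i,0},\ldots,n_{i,m-1})$, and distribution $P_i=\prod_kP_{C_k}(n_{i,k})$, $P_{C_k}(1)=1-P_{C_k}(0)$; i.e. independent bits $C_k$ with $\Pr(C_k=u)=P_{C_k}(u)$ select $\boldsymbol{X}=\boldsymbol{x}_i$, $i=\sum_kC_k2^k$. Hadamard transform: $\tilde{\boldsymbol{x}}_i=\frac1M\sum_j\boldsymbol{x}_jh_{i,j}$, $h_{i,j}=\prod_k(-1)^{n_{i,k}n_{j,k}}$. Channel: $\boldsymbol{Y}=\boldsymbol{H}\circ\boldsymbol{X}+\boldsymbol{Z}$, $\boldsymbol{Z}$ zero-mean Gaussian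 with variance $N_0/2$ per dimension, $\boldsymbol{H}$ real fading vector with common marginal pdf $p_H$, known at the receiver (standard regularity conditions assumed). $E_s=\mathbb{E}[\|\boldsymbol{X}\|^2]$, $\mathrm{SNR}=\mathbb{E}[H^2]E_s/N_0$. BICM-GMI: $I(\mathrm{SNR})=\sum_kI(C_k;\boldsymbol{Y}\mid\boldsymbol{H})$ in bits, as a function of SNR; $\alpha=\frac{dI}{d\,\mathrm{SNR}}\big|_{\mathrm{SNR}=0}$. The constellation is first-order optimal (FOO) if $\alpha=\log_2 e$. *)

theory Defs
  imports "HOL-Probability.Probability"
begin

definition nbit :: "nat \<Rightarrow> nat \<Rightarrow> nat" where
  "nbit i k = (i div 2 ^ k) mod 2"

definition PC :: "(nat \<Rightarrow> real) \<Rightarrow> nat \<Rightarrow> nat \<Rightarrow> real" where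
  "PC q k u = (if u = 0 then q k else 1 - q k)"

definition Psym :: "nat \<Rightarrow> (nat \<Rightarrow> real) \<Rightarrow> nat \<Rightarrow> real" where
  "Psym m q i = (\<Prod>k<m. PC q k (nbit i k))"

definition cmean :: "nat \<Rightarrow> (nat \<Rightarrow> real) \<Rightarrow> (nat \<Rightarrow> real ^ 'n) \<Rightarrow> real ^ 'n" where
  "cmean m q x = (\<Sum>i<2 ^ m. Psym m q i *\<^sub>R x i)"

definition Es :: "nat \<Rightarrow> (nat \<Rightarrow> real) \<Rightarrow> (nat \<Rightarrow> real ^ 'n) \<Rightarrow> real" where
  "Es m q x = (\<Sum>i<2 ^ m. Psym m q i * (norm (x i))\<^sup>2)"

definition hadh :: "nat \<Rightarrow> nat \<Rightarrow> nat \<Rightarrow> real" where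
  "hadh m i j = (\<Prod>k<m. (-1) ^ (nbit i k * nbit j k))"

definition hadamard :: "nat \<Rightarrow> (nat \<Rightarrow> real ^ 'n) \<Rightarrow> nat \<Rightarrow> real ^ 'n" where
  "hadamard m x i = (1 / 2 ^ m) *\<^sub>R (\<Sum>j<2 ^ m. hadh m i j *\<^sub>R x j)"

text \<open>Gaussian density of Y given mean c, noise variance N0/2 per dimension.\<close>
definition gauss :: "real \<Rightarrow> real ^ 'n \<Rightarrow> real ^ 'n \<Rightarrow> real" where
  "gauss N0 c y = (\<Prod>a\<in>UNIV. exp (- (y $ a - c $ a)\<^sup>2 / N0) / sqrt (pi * N0))"

definition hprod :: "real ^ 'n \<Rightarrow> real ^ 'n \<Rightarrow> real ^ 'n" where
  "hprod h v = (\<chi> a. h $ a * v $ a)"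

definition pbit :: "nat \<Rightarrow> (nat \<Rightarrow> real) \<Rightarrow> (nat \<Rightarrow> real ^ 'n) \<Rightarrow> real \<Rightarrow> nat \<Rightarrow> nat
    \<Rightarrow> real ^ 'n \<Rightarrow> real ^ 'n \<Rightarrow> real" where
  "pbit m q x N0 k u h y =
     (\<Sum>i\<in>{i. i < 2 ^ m \<and> nbit i k = u}. Psym m q i / PC q k u * gauss N0 (hprod h (x i)) y)"

definition pout :: "nat \<Rightarrow> (nat \<Rightarrow> real) \<Rightarrow> (nat \<Rightarrow> real ^ 'n) \<Rightarrow> real
    \<Rightarrow> real ^ 'n \<Rightarrow> real ^ 'n \<Rightarrow> real" where
  "pout m q x N0 h y = (\<Sum>i<2 ^ m. Psym m q i * gauss N0 (hprod h (x i)) y)"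

definition MIbit :: "nat \<Rightarrow> (nat \<Rightarrow> real) \<Rightarrow> (nat \<Rightarrow> real ^ 'n) \<Rightarrow> real \<Rightarrow> nat
    \<Rightarrow> real ^ 'n \<Rightarrow> real" where
  "MIbit m q x N0 k h =
     (\<Sum>u\<in>{0, 1}. PC q k u *
        (\<integral>y. pbit m q x N0 k u h y * log 2 (pbit m q x N0 k u h y / pout m q x N0 h y) \<partial>lborel))"

definition EH2 :: "(real \<Rightarrow> real) \<Rightarrow> real" where
  "EH2 pH = (\<integral>t. t\<^sup>2 * pH t \<partial>lborel)"

text \<open>BICM-GMI as a function of SNR = E[H^2] E_s / N0 (so N0 = E[H^2] E_s / SNR);
  at SNR = 0 (N0 = infinity) the GMI is 0.\<close>
definition gmi :: "nat \<Rightarrow> (nat \<Rightarrow> real) \<Rightarrow> (nat \<Rightarrow> real ^ 'n) \<Rightarrow> (real ^ 'n) measure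
    \<Rightarrow> (real \<Rightarrow> real) \<Rightarrow> real \<Rightarrow> real" where
  "gmi m q x PH pH snr =
     (if snr \<le> 0 then 0 else
       (let N0 = EH2 pH * Es m q x / snr in
        \<Sum>k<m. \<integral>h. MIbit m q x N0 k h \<partial>PH))"

definition FOO :: "nat \<Rightarrow> (nat \<Rightarrow> real) \<Rightarrow> (nat \<Rightarrow> real ^ 'n) \<Rightarrow> (real ^ 'n) measure
    \<Rightarrow> (real \<Rightarrow> real) \<Rightarrow> bool" where
  "FOO m q x PH pH \<longleftrightarrow> (gmi m q x PH pH has_real_derivative log 2 (exp 1)) (at_right 0)"

end

theory Submission
  imports Defs "HOL-Real_Asymp.Real_Asymp"
begin

text \<open>
  After rescaling the output by the standard deviation of the noise, the output density becomes a
  Gaussian weight times a mixture \<open>f\<close> of exponentials \<open>exp (2 t z \<bullet> c - t\<^sup>2 \<bar>c\<bar>\<^sup>2)\<close> with \<open>t = 1 / sqrt N0\<close>.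
  The mutual information of a bit is a difference of integrals of \<open>f ln f\<close>, each of which lies between
  \<open>0\<close> and \<open>2 t\<^sup>2 max \<bar>c\<bar>\<^sup>2\<close> and equals \<open>t\<^sup>2 \<bar>mean c\<bar>\<^sup>2 + o(t\<^sup>2)\<close>. Dominated convergence in the fading
  vector then identifies the slope of the GMI at zero with \<open>log 2 e / Es\<close> times
  the sum over \<open>k\<close> of the variances of \<open>E[X | C_k]\<close>.
  Since the centred bits are orthogonal, Es is the sum of \<open>\<bar>\<mu>\<bar>\<^sup>2\<close>, of these variances and of the mean
  square of the residual of \<open>X\<close> after projection onto affine functions of the bits. Hence the
  slope is optimal iff \<open>\<mu> = 0\<close> and \<open>X\<close> is affine in the bits, and the latter says that all Hadamard
  coefficients of degree at least two vanish.
\<close>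

subsection \<open>Gaussian integrals\<close>

lemma Basis_vec_real: "(Basis :: (real ^ 'n) set) = range (\<lambda>a. axis a 1)"
  by (auto simp: Basis_vec_def)

lemma nn_integral_gauss:
  fixes c :: "real ^ 'n"
  assumes "N0 > 0"
  shows "(\<integral>\<^sup>+y. gauss N0 c y \<partial>lborel) = 1"
proof -
  have g: "exp (- (t - r)\<^sup>2 / N0) / sqrt (pi * N0) = normal_density r (sqrt (N0 / 2)) t" for t r
    using assms by (simp add: normal_density_def)
  have inj: "inj (\<lambda>a::'n. axis a (1::real))"
    by (auto intro!: injI simp: axis_eq_axis)
  have "(\<integral>\<^sup>+y. gauss N0 c y \<partial>lborel)
      = (\<integral>\<^sup>+y. (\<Prod>b\<in>Basis. ennreal (normal_density (c \<bullet> b) (sqrt (N0 / 2)) (y \<bullet> b))) \<partial>lborel)"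
    unfolding gauss_def g Basis_vec_real prod.reindex[OF inj]
    by (simp add: inner_axis prod_ennreal)
  also have "\<dots> = (\<Prod>b\<in>Basis. (\<integral>\<^sup>+t. normal_density (c \<bullet> b) (sqrt (N0 / 2)) t \<partial>lborel))"
    by (subst nn_integral_lborel_prod) auto
  also have "\<dots> = 1"
    using assms by (simp add: nn_integral_eq_integral)
  finally show ?thesis .
qed

lemma borel_measurable_vec_nth [measurable]: "(\<lambda>y::real ^ 'n. y $ a) \<in> borel_measurable borel"
  by (intro borel_measurable_continuous_onI continuous_intros)

lemma borel_measurable_gauss [measurable]: "gauss N0 c \<in> borel_measurable borel"
  unfolding gauss_def by measurable

lemma gauss_pos: "N0 > 0 \<Longrightarrow> gauss N0 c y > 0"
  unfolding gauss_def by (intro prod_pos) auto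

lemma gauss_one_nonneg [simp]: "0 \<le> gauss 1 c y"
  using gauss_pos[of 1 c y] by simp

lemma has_bochner_integral_gauss:
  fixes c :: "real ^ 'n"
  assumes "N0 > 0"
  shows "has_bochner_integral lborel (gauss N0 c) 1"
  using nn_integral_gauss[OF assms, of c] gauss_pos[OF assms, of c]
  by (intro has_bochner_integral_nn_integral) (auto intro: less_imp_le)

definition tilt :: "real \<Rightarrow> real ^ 'n \<Rightarrow> real ^ 'n \<Rightarrow> real" where
  "tilt t c z = exp (2 * t * (z \<bullet> c) - t\<^sup>2 * (c \<bullet> c))"

lemma gauss_eq:
  fixes c y :: "real ^ 'n"
  shows "gauss N0 c y = exp (- ((y - c) \<bullet> (y - c)) / N0) / sqrt (pi * N0) ^ CARD('n)"
  by (simp add: gauss_def prod_dividef exp_sum[symmetric] inner_vec_def power2_eq_square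
      sum_divide_distrib sum_negf)

lemma gauss_scale:
  fixes c z :: "real ^ 'n"
  assumes "s > 0"
  shows "s ^ CARD('n) * gauss (s\<^sup>2) c (s *\<^sub>R z) = gauss 1 0 z * tilt (1 / s) c z"
proof -
  have "- ((s *\<^sub>R z - c) \<bullet> (s *\<^sub>R z - c)) / s\<^sup>2 = - (z \<bullet> z) + (2 * (1 / s) * (z \<bullet> c) - (1 / s)\<^sup>2 * (c \<bullet> c))"
    using assms by (simp add: inner_diff inner_commute field_simps power2_eq_square)
  then show ?thesis
    using assms unfolding gauss_eq tilt_def
    by (simp add: real_sqrt_mult power_mult_distrib exp_add[symmetric])
qed

lemma has_bochner_integral_tilt:
  "has_bochner_integral lborel (\<lambda>z. gauss 1 0 z * tilt t c z) 1"
proof -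
  have "gauss 1 0 z * tilt t c z = gauss 1 (t *\<^sub>R c) z" for z
    unfolding gauss_eq tilt_def 
    by (simp add: exp_add[symmetric] inner_diff inner_commute algebra_simps power2_eq_square)
  then show ?thesis by (simp add: has_bochner_integral_gauss)
qed

lemma has_bochner_integral_tilt_tilt:
  "has_bochner_integral lborel (\<lambda>z. gauss 1 0 z * (tilt t c z * tilt t d z)) (exp (2 * t\<^sup>2 * (c \<bullet> d)))"
proof -
  have eq: "exp (2 * t\<^sup>2 * (c \<bullet> d)) * (gauss 1 0 z * tilt t (c + d) z) = gauss 1 0 z * (tilt t c z * tilt t d z)" for z
    unfolding tilt_def
    by (simp add: exp_add[symmetric] inner_add inner_commute algebra_simps)
  show ?thesis
    using has_bochner_integral_mult_right[OF has_bochner_integral_tilt[of t "c + d"], of "exp (2 * t\<^sup>2 * (c \<bullet> d))"]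
    unfolding eq by simp
qed

lemma integrable_gauss_exp_norm:
  "integrable lborel (\<lambda>z::real ^ 'n. gauss 1 0 z * exp (K * norm z))"
proof (rule Bochner_Integration.integrable_bound)
  let ?C = "exp (K\<^sup>2) * sqrt 2 ^ CARD('n)"
  show "integrable lborel (\<lambda>z::real ^ 'n. ?C * gauss 2 0 z)"
    using has_bochner_integral_gauss[of 2 0] by (auto simp: has_bochner_integral_iff)
  show "AE z in lborel. norm (gauss 1 0 z * exp (K * norm z)) \<le> norm (?C * gauss 2 0 (z :: real ^ 'n))"
  proof (rule AE_I2)
    fix z :: "real ^ 'n"
    have "0 \<le> (norm z / 2 - K)\<^sup>2 + (norm z)\<^sup>2 / 4" by simp
    then have "K * norm z - z \<bullet> z \<le> K\<^sup>2 - (z \<bullet> z) / 2"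
      unfolding dot_square_norm by (simp add: power2_eq_square algebra_simps)
    then have "exp (K * norm z - z \<bullet> z) \<le> exp (K\<^sup>2 - (z \<bullet> z) / 2)" by simp
    then show "norm (gauss 1 0 z * exp (K * norm z)) \<le> norm (?C * gauss 2 0 z)"
      using gauss_pos[of 1 0 z] gauss_pos[of 2 0 z]
      by (simp add: gauss_eq real_sqrt_mult power_mult_distrib field_simps exp_add[symmetric] exp_diff)
  qed
qed measurable

definition ent :: "real \<Rightarrow> real" where
  "ent v = v * ln v - v + 1"

lemma borel_measurable_ent [measurable]: "ent \<in> borel_measurable borel"
  unfolding ent_def by measurable

lemma ent_nonneg: "v > 0 \<Longrightarrow> ent v \<ge> 0"
proof -
  assume v: "v > 0"
  have "ln (1 / v) \<le> 1 / v - 1" using v by (intro ln_le_minus_one) auto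
  then have "v * ln (1 / v) \<le> v * (1 / v - 1)" using v by (intro mult_left_mono) auto
  then show ?thesis using v by (simp add: ent_def ln_div algebra_simps)
qed

lemma ent_le_square: "v > 0 \<Longrightarrow> ent v \<le> (v - 1)\<^sup>2"
proof -
  assume v: "v > 0"
  have "v * ln v \<le> v * (v - 1)" using v ln_le_minus_one[of v] by (intro mult_left_mono) auto
  then show ?thesis by (simp add: ent_def power2_eq_square algebra_simps)
qed

lemma ent_le_tangent:
  assumes "v > 0" "l > 0"
  shows "ent v \<le> v\<^sup>2 / l + (ln l - 2) * v + 1"
proof -
  have "ln (v / l) \<le> v / l - 1" using assms by (intro ln_le_minus_one) auto
  then have "v * ln v \<le> v * (v / l - 1 + ln l)" using assms by (intro mult_left_mono) (auto simp: ln_div)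
  then show ?thesis by (simp add: ent_def power2_eq_square algebra_simps)
qed

lemma ent_quotient_tendsto: "((\<lambda>v. ent v / (v - 1)\<^sup>2) \<longlongrightarrow> 1 / 2) (at 1)"
  unfolding ent_def by real_asymp

lemma abs_exp_minus_one_le: "\<bar>exp a - 1\<bar> \<le> \<bar>a\<bar> * exp \<bar>a\<bar>" for a :: real
proof (cases "a \<ge> 0")
  case True
  have "1 - a \<le> exp (- a)" using exp_ge_add_one_self[of "-a"] by simp
  then have "exp a * (1 - a) \<le> exp a * exp (- a)" by (intro mult_left_mono) auto
  then show ?thesis using True by (simp add: exp_minus algebra_simps)
next
  case False
  have "1 - exp a \<le> - a" using exp_ge_add_one_self[of a] by linarith
  also have "- a * 1 \<le> - a * exp (- a)" using False by (intro mult_left_mono) auto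
  finally show ?thesis using False by simp
qed

subsection \<open>Entropy of Gaussian mixtures at low signal level\<close>

lemma exp_difference_quotient_tendsto:
  fixes a b :: real
  shows "((\<lambda>s. s * (exp (2 * (1 / s) * a - (1 / s)\<^sup>2 * b) - 1)) \<longlongrightarrow> 2 * a) at_top"
proof -
  have "((\<lambda>t. exp (2 * t * a - t\<^sup>2 * b)) has_real_derivative 2 * a) (at 0)"
    by (auto intro!: derivative_eq_intros)
  then have "((\<lambda>t. (exp (2 * t * a - t\<^sup>2 * b) - 1) / t) \<longlongrightarrow> 2 * a) (at 0)"
    by (simp add: has_field_derivative_iff)
  moreover have "filterlim (\<lambda>s::real. 1 / s) (at 0) at_top" by real_asymp
  ultimately have "((\<lambda>s. (exp (2 * (1 / s) * a - (1 / s)\<^sup>2 * b) - 1) / (1 / s)) \<longlongrightarrow> 2 * a) at_top"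
    by (rule filterlim_compose)
  then show ?thesis by (simp add: mult.commute)
qed

locale gauss_mixture =
  fixes I :: "'i set" and w :: "'i \<Rightarrow> real" and c :: "'i \<Rightarrow> real ^ 'n"
  assumes finite_I: "finite I" and w_nonneg: "\<And>i. i \<in> I \<Longrightarrow> w i \<ge> 0" and w_sum: "sum w I = 1"
begin

definition mix :: "real \<Rightarrow> real ^ 'n \<Rightarrow> real" where
  "mix t z = (\<Sum>i\<in>I. w i * tilt t (c i) z)"

definition mixent :: "real \<Rightarrow> real" where
  "mixent t = (\<integral>z. gauss 1 0 z * ent (mix t z) \<partial>lborel)"

lemma borel_measurable_mix [measurable]: "mix t \<in> borel_measurable borel"
  unfolding mix_def tilt_def by measurable

lemma mix_pos: "mix t z > 0"
proof -
  obtain i where i: "i \<in> I" "w i > 0"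
    using w_sum w_nonneg by (metis less_eq_real_def sum.neutral zero_neq_one)
  then show ?thesis
    unfolding mix_def using w_nonneg finite_I
    by (intro sum_pos2[of I i]) (auto simp: tilt_def)
qed

lemma has_bochner_integral_mix: "has_bochner_integral lborel (\<lambda>z. gauss 1 0 z * mix t z) 1"
proof -
  have "has_bochner_integral lborel (\<lambda>z. \<Sum>i\<in>I. w i * (gauss 1 0 z * tilt t (c i) z)) (\<Sum>i\<in>I. w i * 1)"
    by (intro has_bochner_integral_sum has_bochner_integral_mult_right has_bochner_integral_tilt)
  then show ?thesis by (simp add: w_sum mix_def sum_distrib_left mult_ac)
qed

lemma has_bochner_integral_mix_square:
  "has_bochner_integral lborel (\<lambda>z. gauss 1 0 z * (mix t z)\<^sup>2)
     (\<Sum>i\<in>I. \<Sum>j\<in>I. w i * w j * exp (2 * t\<^sup>2 * (c i \<bullet> c j)))"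
proof -
  have "has_bochner_integral lborel
      (\<lambda>z. \<Sum>i\<in>I. \<Sum>j\<in>I. w i * w j * (gauss 1 0 z * (tilt t (c i) z * tilt t (c j) z)))
      (\<Sum>i\<in>I. \<Sum>j\<in>I. w i * w j * exp (2 * t\<^sup>2 * (c i \<bullet> c j)))"
    by (intro has_bochner_integral_sum has_bochner_integral_mult_right has_bochner_integral_tilt_tilt)
  then show ?thesis
    by (simp add: mix_def sum_product power2_eq_square sum_distrib_left mult_ac)
qed

lemma has_bochner_integral_mix_variance:
  "has_bochner_integral lborel (\<lambda>z. gauss 1 0 z * (mix t z - 1)\<^sup>2)
     (\<Sum>i\<in>I. \<Sum>j\<in>I. w i * w j * (exp (2 * t\<^sup>2 * (c i \<bullet> c j)) - 1))"
proof -
  have "has_bochner_integral lborel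
      (\<lambda>z. gauss 1 0 z * (mix t z)\<^sup>2 - 2 * (gauss 1 0 z * mix t z) + gauss 1 0 z)
      ((\<Sum>i\<in>I. \<Sum>j\<in>I. w i * w j * exp (2 * t\<^sup>2 * (c i \<bullet> c j))) - 2 * 1 + 1)"
    by (intro has_bochner_integral_add has_bochner_integral_diff has_bochner_integral_mult_right
        has_bochner_integral_mix has_bochner_integral_mix_square has_bochner_integral_gauss) simp
  moreover have "(\<Sum>i\<in>I. \<Sum>j\<in>I. w i * w j) = 1"
    by (simp flip: sum_product add: w_sum)
  ultimately show ?thesis
    by (simp add: power2_eq_square algebra_simps sum_subtractf)
qed

lemma integrable_gauss_ent_mix: "integrable lborel (\<lambda>z. gauss 1 0 z * ent (mix t z))"
proof (rule Bochner_Integration.integrable_bound)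
  show "integrable lborel (\<lambda>z. gauss 1 0 z * (mix t z - 1)\<^sup>2)"
    using has_bochner_integral_mix_variance has_bochner_integral_iff by blast
  show "AE z in lborel. norm (gauss 1 0 z * ent (mix t z)) \<le> norm (gauss 1 0 z * (mix t z - 1)\<^sup>2)"
    using ent_nonneg[OF mix_pos] ent_le_square[OF mix_pos]
    by (auto simp: abs_mult intro!: AE_I2 mult_left_mono)
qed measurable

lemma has_bochner_integral_mix_ln:
  "has_bochner_integral lborel (\<lambda>z. gauss 1 0 z * (mix t z * ln (mix t z))) (mixent t)"
proof -
  have "has_bochner_integral lborel
      (\<lambda>z. gauss 1 0 z * ent (mix t z) + gauss 1 0 z * mix t z - gauss 1 0 z) (mixent t + 1 - 1)"
    unfolding mixent_def
    by (intro has_bochner_integral_add has_bochner_integral_diff has_bochner_integral_mix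
        has_bochner_integral_gauss has_bochner_integral_integrable integrable_gauss_ent_mix) simp
  then show ?thesis by (simp add: ent_def algebra_simps)
qed

lemma mixent_nonneg: "mixent t \<ge> 0"
  unfolding mixent_def
  using ent_nonneg[OF mix_pos] by (intro Bochner_Integration.integral_nonneg) auto

text \<open>The tangent of \<open>ln\<close> is taken at \<open>l = exp (2 t\<^sup>2 B)\<close>, which dominates the second moment of the mixture.
  A bound of order \<open>t\<^sup>2 B\<close> for all \<open>t\<close> is needed to dominate over an unbounded fading vector.\<close>
lemma mixent_le:
  assumes B: "\<And>i. i \<in> I \<Longrightarrow> (norm (c i))\<^sup>2 \<le> B"
  shows "mixent t \<le> 2 * t\<^sup>2 * B"
proof -
  let ?l = "exp (2 * t\<^sup>2 * B)" and ?S = "\<Sum>i\<in>I. \<Sum>j\<in>I. w i * w j * exp (2 * t\<^sup>2 * (c i \<bullet> c j))"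
  have inner: "c i \<bullet> c j \<le> B" if "i \<in> I" "j \<in> I" for i j
  proof -
    have "0 \<le> (norm (c i - c j))\<^sup>2" by simp
    then have "2 * (c i \<bullet> c j) \<le> (norm (c i))\<^sup>2 + (norm (c j))\<^sup>2"
      by (simp only: dot_square_norm[symmetric]) (simp add: inner_diff inner_commute)
    then show ?thesis using B[OF that(1)] B[OF that(2)] by linarith
  qed
  have "?S \<le> (\<Sum>i\<in>I. \<Sum>j\<in>I. w i * w j * ?l)"
    using w_nonneg inner by (intro sum_mono mult_left_mono) (auto intro!: mult_left_mono)
  also have "\<dots> = ?l" by (simp flip: sum_product sum_distrib_right add: w_sum)
  finally have S: "?S / ?l \<le> 1" by simp
  have *: "has_bochner_integral lborel
      (\<lambda>z. gauss 1 0 z * (mix t z)\<^sup>2 / ?l + (2 * t\<^sup>2 * B - 2) * (gauss 1 0 z * mix t z) + gauss 1 0 z)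
      (?S / ?l + (2 * t\<^sup>2 * B - 2) * 1 + 1)"
    by (intro has_bochner_integral_add has_bochner_integral_divide has_bochner_integral_mult_right
        has_bochner_integral_mix has_bochner_integral_mix_square has_bochner_integral_gauss) simp
  have "mixent t \<le> ?S / ?l + (2 * t\<^sup>2 * B - 2) * 1 + 1"
    unfolding mixent_def has_bochner_integral_integral_eq[OF *, symmetric]
  proof (rule integral_mono)
    show "integrable lborel (\<lambda>z. gauss 1 0 z * (mix t z)\<^sup>2 / ?l + (2 * t\<^sup>2 * B - 2) * (gauss 1 0 z * mix t z) + gauss 1 0 z)"
      using * has_bochner_integral_iff by blast
    fix z
    show "gauss 1 0 z * ent (mix t z)
      \<le> gauss 1 0 z * (mix t z)\<^sup>2 / ?l + (2 * t\<^sup>2 * B - 2) * (gauss 1 0 z * mix t z) + gauss 1 0 z"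
      using mult_left_mono[OF ent_le_tangent[OF mix_pos[of t z], of ?l] less_imp_le[OF gauss_pos[of 1 0 z]]]
      by (simp add: algebra_simps)
  qed (rule integrable_gauss_ent_mix)
  from order_trans[OF this add_right_mono[OF add_right_mono[OF S]]] show ?thesis by simp
qed

lemma mix_square_bound:
  assumes R: "\<And>i. i \<in> I \<Longrightarrow> norm (c i) \<le> R" and s: "s \<ge> 1"
  shows "s\<^sup>2 * (mix (1 / s) z - 1)\<^sup>2 \<le> exp (4 * R\<^sup>2) * exp (8 * R * norm z)"
proof -
  let ?L = "2 * norm z * R + R\<^sup>2"
  have I: "I \<noteq> {}" using w_sum by auto
  then have R0: "R \<ge> 0" using R by (meson all_not_in_conv norm_ge_zero order_trans)
  have L0: "?L \<ge> 0" using R0 by simp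
  have tilt_le: "s * \<bar>tilt (1 / s) (c i) z - 1\<bar> \<le> exp (2 * ?L)" if "i \<in> I" for i
  proof -
    let ?a = "2 * (1 / s) * (z \<bullet> c i) - (1 / s)\<^sup>2 * (c i \<bullet> c i)"
    have zc: "\<bar>z \<bullet> c i\<bar> \<le> norm z * R"
      using Cauchy_Schwarz_ineq2[of z "c i"] mult_left_mono[OF R[OF that], of "norm z"] by simp
    have cc: "c i \<bullet> c i \<le> R\<^sup>2"
      using R[OF that] by (simp add: dot_square_norm power_mono)
    have "s * ?a = 2 * (z \<bullet> c i) - (1 / s) * (c i \<bullet> c i)"
      using s by (simp add: field_simps power2_eq_square)
    moreover have "(1 / s) * (c i \<bullet> c i) \<le> 1 * R\<^sup>2" using s cc by (intro mult_mono) auto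
    moreover have "(1 / s) * (c i \<bullet> c i) \<ge> 0" using s by simp
    ultimately have "\<bar>s * ?a\<bar> \<le> ?L" using zc by (simp add: abs_le_iff)
    then have sa: "s * \<bar>?a\<bar> \<le> ?L" using s by (simp add: abs_mult)
    have "1 * \<bar>?a\<bar> \<le> s * \<bar>?a\<bar>" using s by (intro mult_right_mono) auto
    from order_trans[OF this sa] have a: "\<bar>?a\<bar> \<le> ?L" by (simp only: mult_1)
    have "s * \<bar>exp ?a - 1\<bar> \<le> s * (\<bar>?a\<bar> * exp \<bar>?a\<bar>)"
      using s abs_exp_minus_one_le[of ?a] by (intro mult_left_mono) auto
    also have "\<dots> = (s * \<bar>?a\<bar>) * exp \<bar>?a\<bar>" by simp
    also have "\<dots> \<le> ?L * exp ?L" using sa a L0 by (intro mult_mono) auto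
    also have "\<dots> \<le> exp ?L * exp ?L"
      using less_imp_le[OF exp_gt_self[of ?L]] by (intro mult_right_mono) auto
    finally show ?thesis by (simp only: tilt_def exp_add[symmetric] mult_2)
  qed
  have "mix (1 / s) z - 1 = (\<Sum>i\<in>I. w i * (tilt (1 / s) (c i) z - 1))"
    by (simp add: mix_def algebra_simps sum_subtractf w_sum)
  then have "s * \<bar>mix (1 / s) z - 1\<bar> \<le> s * (\<Sum>i\<in>I. \<bar>w i * (tilt (1 / s) (c i) z - 1)\<bar>)"
    using s by (simp add: sum_abs)
  also have "\<dots> = (\<Sum>i\<in>I. w i * (s * \<bar>tilt (1 / s) (c i) z - 1\<bar>))"
    unfolding sum_distrib_left using w_nonneg by (intro sum.cong) (auto simp: abs_mult)
  also have "\<dots> \<le> (\<Sum>i\<in>I. w i * exp (2 * ?L))"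
    using tilt_le w_nonneg by (intro sum_mono mult_left_mono) auto
  also have "\<dots> = exp (2 * ?L)" by (simp flip: sum_distrib_right add: w_sum)
  finally have "(s * \<bar>mix (1 / s) z - 1\<bar>)\<^sup>2 \<le> (exp (2 * ?L))\<^sup>2"
    using s by (intro power_mono) auto
  then show ?thesis
    by (simp add: power_mult_distrib power2_eq_square exp_add[symmetric] algebra_simps)
qed

lemma mix_diff_tendsto: "((\<lambda>s. s * (mix (1 / s) z - 1)) \<longlongrightarrow> 2 * (z \<bullet> (\<Sum>i\<in>I. w i *\<^sub>R c i))) at_top"
proof -
  have eq: "s * (mix (1 / s) z - 1) = (\<Sum>i\<in>I. w i * (s * (tilt (1 / s) (c i) z - 1)))" for s
  proof -
    have "mix (1 / s) z - 1 = (\<Sum>i\<in>I. w i * (tilt (1 / s) (c i) z - 1))"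
      by (simp add: mix_def algebra_simps sum_subtractf w_sum)
    then show ?thesis by (simp add: sum_distrib_left mult_ac)
  qed
  have "((\<lambda>s. s * (mix (1 / s) z - 1)) \<longlongrightarrow> (\<Sum>i\<in>I. w i * (2 * (z \<bullet> c i)))) at_top"
    unfolding eq tilt_def by (intro tendsto_intros exp_difference_quotient_tendsto)
  then show ?thesis by (simp add: inner_sum_right sum_distrib_left mult_ac)
qed

lemma mix_tendsto: "((\<lambda>s. mix (1 / s) z) \<longlongrightarrow> 1) at_top"
proof -
  have "((\<lambda>s. 1 / s * (s * (mix (1 / s) z - 1))) \<longlongrightarrow> 0 * (2 * (z \<bullet> (\<Sum>i\<in>I. w i *\<^sub>R c i)))) at_top"
    by (intro tendsto_mult mix_diff_tendsto) real_asymp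
  moreover have "\<forall>\<^sub>F s in at_top. 1 / s * (s * (mix (1 / s) z - 1)) = mix (1 / s) z - 1"
    using eventually_gt_at_top[of 0] by eventually_elim simp
  ultimately have "((\<lambda>s. mix (1 / s) z - 1) \<longlongrightarrow> 0) at_top"
    by (simp add: tendsto_cong)
  then show ?thesis by (simp add: LIM_zero_iff)
qed

lemma ent_mix_tendsto:
  "((\<lambda>s. s\<^sup>2 * ent (mix (1 / s) z)) \<longlongrightarrow> 2 * (z \<bullet> (\<Sum>i\<in>I. w i *\<^sub>R c i))\<^sup>2) at_top"
proof -
  define r where "r v = (if v = 1 then 1 / 2 else ent v / (v - 1)\<^sup>2)" for v
  have "((\<lambda>v. r v) \<longlongrightarrow> 1 / 2) (at 1)"
    using ent_quotient_tendsto
    by (rule Lim_transform_eventually) (auto simp: r_def eventually_at_filter)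
  moreover have r1: "r 1 = 1 / 2" by (simp add: r_def)
  ultimately have "isCont r 1" by (simp only: isCont_def)
  then have "((\<lambda>s. r (mix (1 / s) z)) \<longlongrightarrow> r 1) at_top"
    using mix_tendsto by (rule isCont_tendsto_compose)
  then have "((\<lambda>s. r (mix (1 / s) z) * (s * (mix (1 / s) z - 1))\<^sup>2)
      \<longlongrightarrow> r 1 * (2 * (z \<bullet> (\<Sum>i\<in>I. w i *\<^sub>R c i)))\<^sup>2) at_top"
    by (intro tendsto_intros mix_diff_tendsto)
  moreover have "ent v = r v * (v - 1)\<^sup>2" for v by (simp add: r_def ent_def)
  ultimately show ?thesis by (simp add: power_mult_distrib mult_ac r1)
qed

lemma mixent_tendsto:
  "((\<lambda>s. s\<^sup>2 * mixent (1 / s)) \<longlongrightarrow> (norm (\<Sum>i\<in>I. w i *\<^sub>R c i))\<^sup>2) at_top"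
proof -
  let ?cb = "\<Sum>i\<in>I. w i *\<^sub>R c i"
  define R where "R = (\<Sum>i\<in>I. norm (c i))"
  have R: "norm (c i) \<le> R" if "i \<in> I" for i
    unfolding R_def using that finite_I by (intro member_le_sum) auto
  let ?D = "\<lambda>z::real ^ 'n. exp (4 * R\<^sup>2) * (gauss 1 0 z * exp (8 * R * norm z))"
  have D: "integrable lborel ?D"
    by (intro integrable_mult_right integrable_gauss_exp_norm)
  have bound: "gauss 1 0 z * (s\<^sup>2 * (mix (1 / s) z - 1)\<^sup>2) \<le> ?D z" if "s \<ge> 1" for s z
    using mult_left_mono[OF mix_square_bound[OF R that, of z] less_imp_le[OF gauss_pos[of 1 0 z]]]
    by (simp add: mult_ac)
  have "((\<lambda>s. \<integral>z. gauss 1 0 z * (s\<^sup>2 * (mix (1 / s) z - 1)\<^sup>2) \<partial>lborel)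
      \<longlongrightarrow> (\<integral>z. gauss 1 0 z * (2 * (z \<bullet> ?cb))\<^sup>2 \<partial>lborel)) at_top"
  proof (rule integral_dominated_convergence_at_top[OF _ _ D])
    show "\<forall>\<^sub>F s in at_top. AE z in lborel. norm (gauss 1 0 z * (s\<^sup>2 * (mix (1 / s) z - 1)\<^sup>2)) \<le> ?D z"
      using eventually_ge_at_top[of 1]
      by eventually_elim (use bound in \<open>auto intro!: AE_I2 simp: abs_mult\<close>)
    show "AE z in lborel. ((\<lambda>s. gauss 1 0 z * (s\<^sup>2 * (mix (1 / s) z - 1)\<^sup>2)) \<longlongrightarrow> gauss 1 0 z * (2 * (z \<bullet> ?cb))\<^sup>2) at_top"
      unfolding power_mult_distrib[symmetric] by (intro AE_I2 tendsto_intros mix_diff_tendsto)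
  qed measurable
  moreover have "((\<lambda>s. \<integral>z. gauss 1 0 z * (s\<^sup>2 * (mix (1 / s) z - 1)\<^sup>2) \<partial>lborel) \<longlongrightarrow> 2 * (?cb \<bullet> ?cb)) at_top"
  proof -
    have eq: "(\<integral>z. gauss 1 0 z * (s\<^sup>2 * (mix (1 / s) z - 1)\<^sup>2) \<partial>lborel)
        = (\<Sum>i\<in>I. \<Sum>j\<in>I. w i * w j * (s\<^sup>2 * (exp (2 * (1 / s)\<^sup>2 * (c i \<bullet> c j)) - 1)))" for s
      using has_bochner_integral_integral_eq[OF has_bochner_integral_mult_right[OF has_bochner_integral_mix_variance, of "s\<^sup>2" "1 / s"]]
      by (simp add: sum_distrib_left mult_ac)
    have lim: "((\<lambda>s. s\<^sup>2 * (exp (2 * (1 / s)\<^sup>2 * a) - 1)) \<longlongrightarrow> 2 * a) at_top" for a :: real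
    proof -
      have "filterlim (\<lambda>s::real. s\<^sup>2) at_top at_top" by real_asymp
      from filterlim_compose[OF exp_difference_quotient_tendsto[of a 0] this]
      show ?thesis by (simp add: power_divide)
    qed
    have "((\<lambda>s. \<integral>z. gauss 1 0 z * (s\<^sup>2 * (mix (1 / s) z - 1)\<^sup>2) \<partial>lborel)
        \<longlongrightarrow> (\<Sum>i\<in>I. \<Sum>j\<in>I. w i * w j * (2 * (c i \<bullet> c j)))) at_top"
      unfolding eq by (intro tendsto_intros lim)
    then show ?thesis
      by (simp add: inner_sum_left inner_sum_right sum_distrib_left mult_ac inner_commute)
  qed
  \<comment> \<open>The Gaussian second moment comes for free by comparing the two limits.\<close>
  ultimately have "(\<integral>z. gauss 1 0 z * (2 * (z \<bullet> ?cb))\<^sup>2 \<partial>lborel) = 2 * (?cb \<bullet> ?cb)"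
    by (intro tendsto_unique[of at_top]) auto
  then have second: "(\<integral>z. gauss 1 0 z * (2 * (z \<bullet> ?cb)\<^sup>2) \<partial>lborel) = (norm ?cb)\<^sup>2"
    by (simp add: power_mult_distrib dot_square_norm mult.left_commute[of _ 2] mult.left_commute[of _ 4])
  have "((\<lambda>s. \<integral>z. gauss 1 0 z * (s\<^sup>2 * ent (mix (1 / s) z)) \<partial>lborel)
      \<longlongrightarrow> (\<integral>z. gauss 1 0 z * (2 * (z \<bullet> ?cb)\<^sup>2) \<partial>lborel)) at_top"
  proof (rule integral_dominated_convergence_at_top[OF _ _ D])
    show "\<forall>\<^sub>F s in at_top. AE z in lborel. norm (gauss 1 0 z * (s\<^sup>2 * ent (mix (1 / s) z))) \<le> ?D z"
      using eventually_ge_at_top[of 1]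
    proof eventually_elim
      case (elim s)
      show ?case
      proof (rule AE_I2)
        fix z
        have "gauss 1 0 z * (s\<^sup>2 * ent (mix (1 / s) z)) \<le> gauss 1 0 z * (s\<^sup>2 * (mix (1 / s) z - 1)\<^sup>2)"
          using gauss_pos[of 1 0 z] ent_le_square[OF mix_pos] by (intro mult_left_mono) auto
        moreover have "0 \<le> gauss 1 0 z * (s\<^sup>2 * ent (mix (1 / s) z))"
          using gauss_pos[of 1 0 z] ent_nonneg[OF mix_pos] by auto
        ultimately show "norm (gauss 1 0 z * (s\<^sup>2 * ent (mix (1 / s) z))) \<le> ?D z"
          using bound[OF elim, of z] by simp
      qed
    qed
    show "AE z in lborel. ((\<lambda>s. gauss 1 0 z * (s\<^sup>2 * ent (mix (1 / s) z))) \<longlongrightarrow> gauss 1 0 z * (2 * (z \<bullet> ?cb)\<^sup>2)) at_top"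
      by (intro AE_I2 tendsto_mult tendsto_const ent_mix_tendsto)
  qed measurable
  moreover have "(\<integral>z. gauss 1 0 z * (s\<^sup>2 * ent (mix (1 / s) z)) \<partial>lborel) = s\<^sup>2 * mixent (1 / s)" for s
    unfolding mixent_def by (simp add: mult.left_commute[of _ "s\<^sup>2"])
  ultimately show ?thesis by (simp add: second)
qed

end

subsection \<open>Functions of independent bits\<close>

lemma nbit_cases: "nbit i k = 0 \<or> nbit i k = 1"
  by (auto simp: nbit_def)

lemma nbit_less: "i < 2 ^ k \<Longrightarrow> nbit i k = 0"
  by (simp add: nbit_def)

lemma nbit_add_power: "k \<le> n \<Longrightarrow> i < 2 ^ n \<Longrightarrow> nbit (i + 2 ^ n) k = (if k = n then 1 else nbit i k)"
proof (cases "k = n")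
  case False
  assume "k \<le> n" "i < 2 ^ n"
  with False obtain d where "n = k + Suc d" by (metis less_natE add_Suc_right le_neq_implies_less)
  then show ?thesis using False by (simp add: nbit_def power_add div_add1_eq)
qed (simp add: nbit_def)

lemma nbit_power: "nbit (2 ^ k) l = (if l = k then 1 else 0)"
proof (cases "l \<le> k")
  case True
  then show ?thesis using nbit_add_power[of l k 0] by (simp add: nbit_def)
next
  case False
  then show ?thesis by (simp add: nbit_less)
qed

lemma mod_power_eq_if_nbit_eq:
  "(\<And>k. k < n \<Longrightarrow> nbit i k = nbit j k) \<Longrightarrow> i mod 2 ^ n = j mod 2 ^ n"
proof (induction n)
  case (Suc n)
  have "a mod 2 ^ Suc n = 2 ^ n * nbit a n + a mod 2 ^ n" for a :: nat
    using mod_mult2_eq[of a "2 ^ n" 2] by (simp add: nbit_def mult.commute)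
  then show ?case using Suc by simp
qed simp

lemma sum_prod_nbit:
  fixes g :: "nat \<Rightarrow> nat \<Rightarrow> real"
  shows "(\<Sum>i<2 ^ n. \<Prod>k<n. g k (nbit i k)) = (\<Prod>k<n. g k 0 + g k 1)"
proof (induction n)
  case (Suc n)
  let ?f = "\<lambda>i. \<Prod>k<Suc n. g k (nbit i k)"
  have "sum ?f {..<2 ^ Suc n} = sum ?f {0..<2 ^ n} + sum ?f {2 ^ n..<2 ^ n + 2 ^ n}"
    by (subst sum.atLeastLessThan_concat) (auto simp: lessThan_atLeast0 mult_2)
  also have "sum ?f {2 ^ n..<2 ^ n + 2 ^ n} = (\<Sum>i<2 ^ n. ?f (i + 2 ^ n))"
    using sum.shift_bounds_nat_ivl[of ?f 0 "2 ^ n" "2 ^ n"] by (simp add: lessThan_atLeast0)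
  also have "\<dots> = (\<Sum>i<2 ^ n. (\<Prod>k<n. g k (nbit i k)) * g n 1)"
    by (intro sum.cong) (auto simp: nbit_add_power intro!: prod.cong)
  also have "sum ?f {0..<2 ^ n} = (\<Sum>i<2 ^ n. (\<Prod>k<n. g k (nbit i k)) * g n 0)"
    by (intro sum.cong) (auto simp: nbit_less lessThan_atLeast0)
  finally show ?case
    unfolding sum_distrib_right[symmetric] Suc by (simp add: algebra_simps)
qed simp

lemma sum_Psym_prod:
  "(\<Sum>i<2 ^ m. Psym m q i * (\<Prod>k<m. g k (nbit i k))) = (\<Prod>k<m. q k * g k 0 + (1 - q k) * g k 1)"
  using sum_prod_nbit[where n = m and g = "\<lambda>k u. PC q k u * g k u"]
  by (simp add: Psym_def prod.distrib PC_def)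

lemma sum_Psym: "(\<Sum>i<2 ^ m. Psym m q i) = 1"
  using sum_Psym_prod[of m q "\<lambda>_ _. 1"] by simp

lemma sum_Psym_bit:
  assumes "k < m"
  shows "(\<Sum>i<2 ^ m. Psym m q i * f (nbit i k)) = q k * f 0 + (1 - q k) * f 1"
proof -
  let ?g = "\<lambda>j u. if j = k then f u else 1"
  have "(\<Sum>i<2 ^ m. Psym m q i * f (nbit i k)) = (\<Sum>i<2 ^ m. Psym m q i * (\<Prod>j<m. ?g j (nbit i j)))"
    using assms by (simp add: prod.delta)
  also have "\<dots> = (\<Prod>j<m. if j = k then q k * f 0 + (1 - q k) * f 1 else 1)"
    unfolding sum_Psym_prod[of m q ?g] by (intro prod.cong) auto
  finally show ?thesis using assms by (simp add: prod.delta)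
qed

lemma sum_Psym_bit_bit:
  assumes "k < m" "l < m" "k \<noteq> l"
  shows "(\<Sum>i<2 ^ m. Psym m q i * (f (nbit i k) * g (nbit i l)))
    = (q k * f 0 + (1 - q k) * f 1) * (q l * g 0 + (1 - q l) * g 1)"
proof -
  let ?g = "\<lambda>j u. (if j = k then f u else 1) * (if j = l then g u else 1)"
  have "(\<Sum>i<2 ^ m. Psym m q i * (f (nbit i k) * g (nbit i l)))
      = (\<Sum>i<2 ^ m. Psym m q i * (\<Prod>j<m. ?g j (nbit i j)))"
    using assms by (simp add: prod.delta prod.distrib)
  also have "\<dots> = (\<Prod>j<m. (if j = k then q k * f 0 + (1 - q k) * f 1 else 1)
      * (if j = l then q l * g 0 + (1 - q l) * g 1 else 1))"
    unfolding sum_Psym_prod[of m q ?g] using assms(3) by (intro prod.cong) auto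
  finally show ?thesis using assms by (simp add: prod.delta prod.distrib)
qed

lemma hadh_power: "k < m \<Longrightarrow> hadh m (2 ^ k) j = 1 - 2 * real (nbit j k)"
  using nbit_cases[of j k]
  by (auto simp: hadh_def nbit_power if_distrib[of "\<lambda>u. (-1) ^ (u * _)"] prod.delta cong: if_cong)

lemma hadh_commute: "hadh m i j = hadh m j i"
  by (simp add: hadh_def mult.commute)

lemma hadh_orthogonal:
  assumes "i < 2 ^ m" "l < 2 ^ m"
  shows "(\<Sum>j<2 ^ m. hadh m i j * hadh m l j) = (if i = l then 2 ^ m else 0)"
proof -
  let ?p = "\<lambda>k. 1 + (-1) ^ nbit i k * (-1) ^ nbit l k :: real"
  have "(\<Sum>j<2 ^ m. hadh m i j * hadh m l j) = (\<Prod>k<m. ?p k)"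
    using sum_prod_nbit[where n = m and g = "\<lambda>k u. (-1) ^ (nbit i k * u) * (-1) ^ (nbit l k * u)"]
    by (simp add: hadh_def prod.distrib)
  also have "\<dots> = (if i = l then 2 ^ m else 0)"
  proof (cases "i = l")
    case True
    then show ?thesis by (simp flip: power_add)
  next
    case False
    then obtain k where k: "k < m" "nbit i k \<noteq> nbit l k"
      using mod_power_eq_if_nbit_eq[of m i l] assms by auto
    then have "?p k = 0" using nbit_cases[of i k] nbit_cases[of l k] by auto
    then have "(\<Prod>k<m. ?p k) = 0" using k(1) by (intro prod_zero) auto
    then show ?thesis using False by simp
  qed
  finally show ?thesis .
qed

lemma hadamard_inverse:
  assumes "j < 2 ^ m"
  shows "x j = (\<Sum>i<2 ^ m. hadh m i j *\<^sub>R hadamard m x i)"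
proof -
  have "hadh m i j *\<^sub>R hadamard m x i = (1 / 2 ^ m) *\<^sub>R (\<Sum>l<2 ^ m. (hadh m j i * hadh m l i) *\<^sub>R x l)" for i
    unfolding hadamard_def scaleR_sum_right hadh_commute[of m i] by (intro sum.cong) auto
  then have "(\<Sum>i<2 ^ m. hadh m i j *\<^sub>R hadamard m x i)
      = (1 / 2 ^ m) *\<^sub>R (\<Sum>i<2 ^ m. \<Sum>l<2 ^ m. (hadh m j i * hadh m l i) *\<^sub>R x l)"
    by (simp add: scaleR_sum_right)
  also have "(\<Sum>i<2 ^ m. \<Sum>l<2 ^ m. (hadh m j i * hadh m l i) *\<^sub>R x l)
      = (\<Sum>l<2 ^ m. (\<Sum>i<2 ^ m. hadh m j i * hadh m l i) *\<^sub>R x l)"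
    by (subst sum.swap) (simp add: scaleR_sum_left)
  also have "\<dots> = (\<Sum>l<2 ^ m. if l = j then 2 ^ m *\<^sub>R x l else 0)"
    using assms by (intro sum.cong) (auto simp: hadh_orthogonal)
  also have "\<dots> = 2 ^ m *\<^sub>R x j"
    using assms by (simp add: sum.delta)
  finally show ?thesis by simp
qed

lemma hadamard_sparse_iff_affine:
  "(\<forall>j<2 ^ m. j \<noteq> 0 \<and> (\<forall>k<m. j \<noteq> 2 ^ k) \<longrightarrow> hadamard m x j = 0) \<longleftrightarrow>
   (\<exists>a d. \<forall>i<2 ^ m. x i = a + (\<Sum>k<m. real (nbit i k) *\<^sub>R d k))" (is "?L \<longleftrightarrow> ?R")
proof
  assume L: ?L
  let ?y = "hadamard m x" and ?J = "(\<lambda>k. 2 ^ k) ` {..<m} :: nat set"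
  have inj: "inj_on (\<lambda>k. 2 ^ k :: nat) {..<m}" by (auto intro: inj_onI)
  have zero: "hadh m 0 j = 1" for j by (simp add: hadh_def nbit_def)
  have "x i = (?y 0 + (\<Sum>k<m. ?y (2 ^ k))) + (\<Sum>k<m. real (nbit i k) *\<^sub>R ((-2) *\<^sub>R ?y (2 ^ k)))"
    if i: "i < 2 ^ m" for i
  proof -
    have "x i = (\<Sum>j<2 ^ m. hadh m j i *\<^sub>R ?y j)" by (rule hadamard_inverse[OF i])
    also have "\<dots> = (\<Sum>j\<in>insert 0 ?J. hadh m j i *\<^sub>R ?y j)"
      using L by (intro sum.mono_neutral_right) auto
    also have "\<dots> = ?y 0 + (\<Sum>k<m. hadh m (2 ^ k) i *\<^sub>R ?y (2 ^ k))"
      by (subst sum.insert) (auto simp: zero sum.reindex[OF inj])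
    also have "(\<Sum>k<m. hadh m (2 ^ k) i *\<^sub>R ?y (2 ^ k))
        = (\<Sum>k<m. ?y (2 ^ k) + real (nbit i k) *\<^sub>R ((-2) *\<^sub>R ?y (2 ^ k)))"
      by (intro sum.cong) (auto simp: hadh_power algebra_simps)
    finally show ?thesis by (simp only: sum.distrib add.assoc)
  qed
  then show ?R
    by (intro exI[of _ "?y 0 + (\<Sum>k<m. ?y (2 ^ k))"] exI[of _ "\<lambda>k. (-2) *\<^sub>R ?y (2 ^ k)"]) simp
next
  assume ?R
  then obtain a d where x: "\<And>i. i < 2 ^ m \<Longrightarrow> x i = a + (\<Sum>k<m. real (nbit i k) *\<^sub>R d k)" by blast
  show ?L
  proof (intro allI impI)
    fix j :: nat assume j: "j < 2 ^ m" and nj: "j \<noteq> 0 \<and> (\<forall>k<m. j \<noteq> 2 ^ k)"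
    have one: "hadh m 0 i = 1" for i by (simp add: hadh_def nbit_def)
    have s0: "(\<Sum>i<2 ^ m. hadh m j i) = 0"
      using hadh_orthogonal[OF j, of 0] nj by (simp add: one)
    have sk: "(\<Sum>i<2 ^ m. hadh m j i * real (nbit i k)) = 0" if k: "k < m" for k
    proof -
      have "(\<Sum>i<2 ^ m. hadh m j i * hadh m (2 ^ k) i) = 0"
        using hadh_orthogonal[OF j, of "2 ^ k"] nj k by auto
      then have "(\<Sum>i<2 ^ m. hadh m j i) - 2 * (\<Sum>i<2 ^ m. hadh m j i * real (nbit i k)) = 0"
        by (simp add: hadh_power[OF k] algebra_simps sum_subtractf sum_distrib_left)
      then show ?thesis using s0 by simp
    qed
    have "(\<Sum>i<2 ^ m. hadh m j i *\<^sub>R x i)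
        = (\<Sum>i<2 ^ m. hadh m j i *\<^sub>R a + (\<Sum>k<m. (hadh m j i * real (nbit i k)) *\<^sub>R d k))"
      by (intro sum.cong) (auto simp: x scaleR_add_right scaleR_sum_right)
    also have "\<dots> = (\<Sum>i<2 ^ m. hadh m j i) *\<^sub>R a
        + (\<Sum>k<m. (\<Sum>i<2 ^ m. hadh m j i * real (nbit i k)) *\<^sub>R d k)"
      by (simp add: sum.distrib scaleR_sum_left sum.swap[of _ "{..<m}" "{..<2 ^ m}"])
    also have "\<dots> = 0" using s0 sk by simp
    finally show "hadamard m x j = 0" by (simp add: hadamard_def)
  qed
qed

lemma Psym_pos: "(\<And>k. k < m \<Longrightarrow> 0 < q k \<and> q k < 1) \<Longrightarrow> Psym m q i > 0"
  unfolding Psym_def PC_def by (intro prod_pos) auto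

definition bitmean :: "nat \<Rightarrow> (nat \<Rightarrow> real) \<Rightarrow> (nat \<Rightarrow> real ^ 'n) \<Rightarrow> nat \<Rightarrow> nat \<Rightarrow> real ^ 'n" where
  "bitmean m q x k u = (\<Sum>i\<in>{i. i < 2 ^ m \<and> nbit i k = u}. (Psym m q i / PC q k u) *\<^sub>R x i)"

lemma sum_split_nbit:
  fixes f :: "nat \<Rightarrow> 'b::comm_monoid_add"
  shows "(\<Sum>i<2 ^ m. f i) = (\<Sum>i\<in>{i. i < 2 ^ m \<and> nbit i k = 0}. f i) + (\<Sum>i\<in>{i. i < 2 ^ m \<and> nbit i k = 1}. f i)"
proof -
  have split: "{..<2 ^ m} = {i. i < 2 ^ m \<and> nbit i k = 0} \<union> {i. i < 2 ^ m \<and> nbit i k = 1}"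
    using nbit_cases[of _ k] by auto
  show ?thesis unfolding split by (intro sum.union_disjoint) auto
qed

lemma sum_Psym_nbit_eq:
  assumes "k < m" and u: "u = 0 \<or> u = 1"
  shows "(\<Sum>i\<in>{i. i < 2 ^ m \<and> nbit i k = u}. Psym m q i) = PC q k u"
proof -
  have "(\<Sum>i\<in>{i. i < 2 ^ m \<and> nbit i k = u}. Psym m q i)
      = (\<Sum>i<2 ^ m. Psym m q i * (if nbit i k = u then 1 else 0))"
    by (intro sum.mono_neutral_cong_left) auto
  also have "\<dots> = PC q k u"
    using sum_Psym_bit[OF assms(1), of q "\<lambda>v. if v = u then 1 else 0"] u by (auto simp: PC_def)
  finally show ?thesis .
qed

locale bit_probs =
  fixes m :: nat and q :: "nat \<Rightarrow> real"
  assumes q: "\<And>k. k < m \<Longrightarrow> 0 < q k \<and> q k < 1"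
begin

definition ev :: "(nat \<Rightarrow> 'b::real_vector) \<Rightarrow> 'b" where
  "ev f = (\<Sum>i<2 ^ m. Psym m q i *\<^sub>R f i)"

definition cbit :: "nat \<Rightarrow> nat \<Rightarrow> real" where
  "cbit k i = real (nbit i k) - (1 - q k)"

lemma ev_cbit: "k < m \<Longrightarrow> ev (cbit k) = 0"
  using sum_Psym_bit[of k m q "\<lambda>u. real u - (1 - q k)"]
  by (simp add: ev_def cbit_def algebra_simps)

lemma ev_cbit_cbit:
  assumes "k < m" "l < m"
  shows "ev (\<lambda>i. cbit k i * cbit l i) = (if k = l then q k * (1 - q k) else 0)"
proof (cases "k = l")
  case True
  then show ?thesis
    using sum_Psym_bit[of k m q "\<lambda>u. (real u - (1 - q k))\<^sup>2"] assms
    by (simp add: ev_def cbit_def algebra_simps power2_eq_square)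
next
  case False
  then show ?thesis
    using sum_Psym_bit_bit[of k m l q "\<lambda>u. real u - (1 - q k)" "\<lambda>u. real u - (1 - q l)"] assms
    by (simp add: ev_def cbit_def algebra_simps)
qed

lemma cmean_bitmean:
  assumes "k < m"
  shows "cmean m q x = q k *\<^sub>R bitmean m q x k 0 + (1 - q k) *\<^sub>R bitmean m q x k 1"
  using q[OF assms]
  by (simp add: cmean_def sum_split_nbit[of _ m k] bitmean_def scaleR_sum_right PC_def)

definition bitdiff :: "(nat \<Rightarrow> real ^ 'n) \<Rightarrow> nat \<Rightarrow> real ^ 'n" where
  "bitdiff x k = bitmean m q x k 1 - bitmean m q x k 0"

lemma bit_variance:
  assumes "k < m"
  shows "q k * (norm (bitmean m q x k 0))\<^sup>2 + (1 - q k) * (norm (bitmean m q x k 1))\<^sup>2 - (norm (cmean m q x))\<^sup>2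
    = q k * (1 - q k) * (norm (bitdiff x k))\<^sup>2"
  unfolding cmean_bitmean[OF assms] bitdiff_def dot_square_norm[symmetric]
  by (simp add: inner_diff inner_add inner_commute algebra_simps)

lemma ev_cbit_scaleR:
  assumes "k < m"
  shows "ev (\<lambda>i. cbit k i *\<^sub>R x i) = (q k * (1 - q k)) *\<^sub>R bitdiff x k"
proof -
  have "ev (\<lambda>i. real (nbit i k) *\<^sub>R x i) = (1 - q k) *\<^sub>R bitmean m q x k 1"
    using q[OF assms] by (simp add: ev_def sum_split_nbit[of _ m k] bitmean_def scaleR_sum_right PC_def)
  moreover have "ev (\<lambda>i. cbit k i *\<^sub>R x i) = ev (\<lambda>i. real (nbit i k) *\<^sub>R x i) - (1 - q k) *\<^sub>R cmean m q x"
    by (simp add: ev_def cbit_def cmean_def scaleR_sum_right sum_subtractf[symmetric] algebra_simps)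
  ultimately have e: "ev (\<lambda>i. cbit k i *\<^sub>R x i) = (1 - q k) *\<^sub>R bitmean m q x k 1 - (1 - q k) *\<^sub>R cmean m q x"
    by simp
  show ?thesis
    unfolding e cmean_bitmean[OF assms] bitdiff_def by (simp add: vec_eq_iff algebra_simps)
qed

definition resid :: "(nat \<Rightarrow> real ^ 'n) \<Rightarrow> nat \<Rightarrow> real ^ 'n" where
  "resid x i = x i - (cmean m q x + (\<Sum>k<m. cbit k i *\<^sub>R bitdiff x k))"

lemma ev_add: "ev (\<lambda>i. f i + g i) = ev f + ev g"
  by (simp add: ev_def scaleR_add_right sum.distrib)

lemma ev_diff: "ev (\<lambda>i. f i - g i) = ev f - ev g"
  by (simp add: ev_def scaleR_diff_right sum_subtractf)

lemma ev_sum: "ev (\<lambda>i. \<Sum>k\<in>K. f k i) = (\<Sum>k\<in>K. ev (f k))"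
  unfolding ev_def scaleR_sum_right by (rule sum.swap)

lemma ev_scaleR_const: "ev (\<lambda>i. g i *\<^sub>R v) = ev g *\<^sub>R v"
  by (simp add: ev_def scaleR_sum_left)

lemma ev_const: "ev (\<lambda>i. v) = v"
  by (simp flip: scaleR_sum_left add: ev_def sum_Psym)

lemma ev_inner_const: "ev (\<lambda>i. f i \<bullet> v) = ev f \<bullet> v"
  by (simp add: ev_def inner_sum_left)

lemma ev_resid: "ev (resid x) = 0"
proof -
  have "ev (resid x) = ev x - (cmean m q x + (\<Sum>k<m. ev (cbit k) *\<^sub>R bitdiff x k))"
    unfolding resid_def ev_diff ev_add ev_const ev_sum ev_scaleR_const ..
  then show ?thesis by (simp add: ev_cbit) (simp add: ev_def cmean_def)
qed

lemma ev_cbit_resid: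
  assumes "k < m"
  shows "ev (\<lambda>i. cbit k i *\<^sub>R resid x i) = 0"
proof -
  have "ev (\<lambda>i. cbit k i *\<^sub>R resid x i)
      = ev (\<lambda>i. cbit k i *\<^sub>R x i - (cbit k i *\<^sub>R cmean m q x + (\<Sum>l<m. (cbit k i * cbit l i) *\<^sub>R bitdiff x l)))"
    by (simp add: resid_def scaleR_diff_right scaleR_add_right scaleR_sum_right)
  also have "\<dots> = ev (\<lambda>i. cbit k i *\<^sub>R x i) - (ev (cbit k) *\<^sub>R cmean m q x + (\<Sum>l<m. ev (\<lambda>i. cbit k i * cbit l i) *\<^sub>R bitdiff x l))"
    unfolding ev_diff ev_add ev_sum ev_scaleR_const ..
  also have "(\<Sum>l<m. ev (\<lambda>i. cbit k i * cbit l i) *\<^sub>R bitdiff x l)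
      = (\<Sum>l<m. if l = k then (q k * (1 - q k)) *\<^sub>R bitdiff x k else 0)"
    by (intro sum.cong) (use assms in \<open>auto simp: ev_cbit_cbit\<close>)
  finally show ?thesis
    using assms by (simp add: ev_cbit ev_cbit_scaleR sum.delta)
qed

lemma ev_resid_inner_affine:
  "ev (\<lambda>i. resid x i \<bullet> (a + (\<Sum>k<m. cbit k i *\<^sub>R d k))) = 0"
proof -
  have "ev (\<lambda>i. resid x i \<bullet> (a + (\<Sum>k<m. cbit k i *\<^sub>R d k)))
      = ev (\<lambda>i. resid x i \<bullet> a + (\<Sum>k<m. (cbit k i *\<^sub>R resid x i) \<bullet> d k))"
    by (simp add: inner_add_right inner_sum_right)
  also have "\<dots> = ev (resid x) \<bullet> a + (\<Sum>k<m. ev (\<lambda>i. cbit k i *\<^sub>R resid x i) \<bullet> d k)"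
    unfolding ev_add ev_sum ev_inner_const ..
  finally show ?thesis by (simp add: ev_resid ev_cbit_resid)
qed

lemma Es_decomposition:
  "Es m q x = (norm (cmean m q x))\<^sup>2 + (\<Sum>k<m. q k * (1 - q k) * (norm (bitdiff x k))\<^sup>2)
     + (\<Sum>i<2 ^ m. Psym m q i * (norm (resid x i))\<^sup>2)"
proof -
  let ?mu = "cmean m q x" and ?d = "bitdiff x"
  let ?S = "\<lambda>i. \<Sum>k<m. cbit k i *\<^sub>R ?d k"
  let ?L = "\<lambda>i. ?mu + ?S i"
  have x: "x i = resid x i + ?L i" for i by (simp add: resid_def)
  have "Es m q x = ev (\<lambda>i. x i \<bullet> x i)" by (simp add: Es_def ev_def dot_square_norm)
  also have "\<dots> = ev (\<lambda>i. resid x i \<bullet> resid x i + (resid x i \<bullet> ?L i + resid x i \<bullet> ?L i) + ?L i \<bullet> ?L i)"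
    by (subst (1 2) x) (simp only: inner_add_left inner_add_right inner_commute add_ac)
  also have "\<dots> = ev (\<lambda>i. resid x i \<bullet> resid x i) + ev (\<lambda>i. ?L i \<bullet> ?L i)"
    unfolding ev_add ev_resid_inner_affine by simp
  also have "ev (\<lambda>i. ?L i \<bullet> ?L i) = ev (\<lambda>i. ?mu \<bullet> ?mu + (\<Sum>k<m. cbit k i *\<^sub>R (2 * (?d k \<bullet> ?mu)))
      + (\<Sum>k<m. \<Sum>l<m. (cbit k i * cbit l i) *\<^sub>R (?d k \<bullet> ?d l)))"
    by (simp add: inner_add_left inner_add_right inner_sum_left inner_sum_right inner_commute
        sum_distrib_left algebra_simps)
  also have "\<dots> = ?mu \<bullet> ?mu + (\<Sum>k<m. ev (cbit k) *\<^sub>R (2 * (?d k \<bullet> ?mu)))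
      + (\<Sum>k<m. \<Sum>l<m. ev (\<lambda>i. cbit k i * cbit l i) *\<^sub>R (?d k \<bullet> ?d l))"
    unfolding ev_add ev_const ev_sum ev_scaleR_const ..
  also have "(\<Sum>k<m. \<Sum>l<m. ev (\<lambda>i. cbit k i * cbit l i) *\<^sub>R (?d k \<bullet> ?d l))
      = (\<Sum>k<m. \<Sum>l<m. if l = k then q k * (1 - q k) * (?d k \<bullet> ?d k) else 0)"
  proof (intro sum.cong refl)
    fix k l assume "k \<in> {..<m}" "l \<in> {..<m}"
    then show "ev (\<lambda>i. cbit k i * cbit l i) *\<^sub>R (?d k \<bullet> ?d l)
        = (if l = k then q k * (1 - q k) * (?d k \<bullet> ?d k) else 0)"
      by (subst ev_cbit_cbit) auto
  qed
  also have "\<dots> = (\<Sum>k<m. q k * (1 - q k) * (norm (?d k))\<^sup>2)"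
    by (intro sum.cong) (auto simp: sum.delta dot_square_norm)
  also have "(\<Sum>k<m. ev (cbit k) *\<^sub>R (2 * (?d k \<bullet> ?mu))) = 0"
    using ev_cbit by (intro sum.neutral) (metis lessThan_iff scaleR_zero_left)
  finally show ?thesis by (simp add: ev_def dot_square_norm)
qed

lemma Es_eq_bit_variance_iff:
  "Es m q x = (\<Sum>k<m. q k * (1 - q k) * (norm (bitdiff x k))\<^sup>2) \<longleftrightarrow>
     cmean m q x = 0 \<and> (\<forall>j<2 ^ m. j \<noteq> 0 \<and> (\<forall>k<m. j \<noteq> 2 ^ k) \<longrightarrow> hadamard m x j = 0)"
proof -
  let ?Q = "\<Sum>i<2 ^ m. Psym m q i * (norm (resid x i))\<^sup>2"
  have pos: "Psym m q i > 0" for i by (rule Psym_pos) (rule q)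
  have Q0: "?Q \<ge> 0" using pos by (intro sum_nonneg) (simp add: less_imp_le)
  have "?Q = 0 \<longleftrightarrow> (\<forall>i<2 ^ m. resid x i = 0)"
  proof -
    have "?Q = 0 \<longleftrightarrow> (\<forall>i\<in>{..<2 ^ m}. Psym m q i * (norm (resid x i))\<^sup>2 = 0)"
      using pos by (intro sum_nonneg_eq_0_iff) (auto simp: less_imp_le)
    then show ?thesis using pos by (auto simp: less_imp_neq[symmetric])
  qed
  also have "\<dots> \<longleftrightarrow> (\<exists>a d. \<forall>i<2 ^ m. x i = a + (\<Sum>k<m. real (nbit i k) *\<^sub>R d k))"
  proof
    assume "\<forall>i<2 ^ m. resid x i = 0"
    then have "\<forall>i<2 ^ m. x i = (cmean m q x - (\<Sum>k<m. (1 - q k) *\<^sub>R bitdiff x k))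
        + (\<Sum>k<m. real (nbit i k) *\<^sub>R bitdiff x k)"
      by (simp add: resid_def cbit_def scaleR_diff_left sum_subtractf sum.distrib algebra_simps)
    then show "\<exists>a d. \<forall>i<2 ^ m. x i = a + (\<Sum>k<m. real (nbit i k) *\<^sub>R d k)" by blast
  next
    assume "\<exists>a d. \<forall>i<2 ^ m. x i = a + (\<Sum>k<m. real (nbit i k) *\<^sub>R d k)"
    then obtain a d where ad: "\<And>i. i < 2 ^ m \<Longrightarrow> x i = a + (\<Sum>k<m. real (nbit i k) *\<^sub>R d k)" by blast
    let ?a = "a + (\<Sum>k<m. (1 - q k) *\<^sub>R d k) - cmean m q x"
    have r: "resid x i = ?a + (\<Sum>k<m. cbit k i *\<^sub>R (d k - bitdiff x k))" if "i < 2 ^ m" for i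
      by (simp add: resid_def ad[OF that] cbit_def scaleR_diff_left scaleR_diff_right sum_subtractf sum.distrib algebra_simps)
    have "?Q = ev (\<lambda>i. resid x i \<bullet> resid x i)" by (simp add: ev_def dot_square_norm)
    also have "\<dots> = ev (\<lambda>i. resid x i \<bullet> (?a + (\<Sum>k<m. cbit k i *\<^sub>R (d k - bitdiff x k))))"
      unfolding ev_def using r by (intro sum.cong) auto
    also have "\<dots> = 0" by (rule ev_resid_inner_affine)
    finally show "\<forall>i<2 ^ m. resid x i = 0"
      using \<open>?Q = 0 \<longleftrightarrow> (\<forall>i<2 ^ m. resid x i = 0)\<close> by blast
  qed
  also have "\<dots> \<longleftrightarrow> (\<forall>j<2 ^ m. j \<noteq> 0 \<and> (\<forall>k<m. j \<noteq> 2 ^ k) \<longrightarrow> hadamard m x j = 0)"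
    by (rule hadamard_sparse_iff_affine[symmetric])
  finally have "?Q = 0 \<longleftrightarrow> (\<forall>j<2 ^ m. j \<noteq> 0 \<and> (\<forall>k<m. j \<noteq> 2 ^ k) \<longrightarrow> hadamard m x j = 0)" .
  moreover have "Es m q x = (\<Sum>k<m. q k * (1 - q k) * (norm (bitdiff x k))\<^sup>2) \<longleftrightarrow> (norm (cmean m q x))\<^sup>2 + ?Q = 0"
    unfolding Es_decomposition by linarith
  moreover have "(norm (cmean m q x))\<^sup>2 + ?Q = 0 \<longleftrightarrow> cmean m q x = 0 \<and> ?Q = 0"
    using Q0 by (simp add: add_nonneg_eq_0_iff)
  ultimately show ?thesis by blast
qed

end

subsection \<open>Mutual information of a bit and slope of the GMI\<close>

lemma lborel_integral_scaleR:
  fixes f :: "'a::euclidean_space \<Rightarrow> real"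
  assumes [measurable]: "f \<in> borel_measurable borel" and "s > 0"
  shows "(\<integral>y. f y \<partial>lborel) = (\<integral>z. s ^ DIM('a) * f (s *\<^sub>R z) \<partial>lborel)"
proof -
  have "(\<integral>y. f y \<partial>lborel) = (\<integral>y. f y \<partial>density (distr lborel borel (\<lambda>x. 0 + s *\<^sub>R x)) (\<lambda>_. \<bar>s\<bar> ^ DIM('a)))"
    using arg_cong[OF lborel_affine[of s "0::'a"], of "\<lambda>M. \<integral>y. f y \<partial>M"] assms(2) by blast
  also have "\<dots> = (\<integral>z. s ^ DIM('a) * f (s *\<^sub>R z) \<partial>lborel)"
    using assms(2) by (subst integral_density) (auto simp: integral_distr)
  finally show ?thesis .
qed

lemma hprod_sum_scaleR: "(\<Sum>i\<in>I. w i *\<^sub>R hprod h (x i)) = hprod h (\<Sum>i\<in>I. w i *\<^sub>R x i)"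
  by (simp add: hprod_def vec_eq_iff sum_component sum_distrib_left mult_ac)

lemma norm_hprod_square: "(norm (hprod h v))\<^sup>2 = (\<Sum>a\<in>UNIV. (v $ a)\<^sup>2 * (h $ a)\<^sup>2)"
  by (simp add: hprod_def norm_vec_def L2_set_def sum_nonneg power_mult_distrib mult.commute)

lemma norm_hprod_le: "(norm (hprod h v))\<^sup>2 \<le> (norm h)\<^sup>2 * (norm v)\<^sup>2"
proof -
  have "(norm (hprod h v))\<^sup>2 \<le> (\<Sum>a\<in>UNIV. (norm v)\<^sup>2 * (h $ a)\<^sup>2)"
    unfolding norm_hprod_square using component_le_norm_cart[of v]
    by (intro sum_mono mult_right_mono) (auto simp: abs_le_square_iff[symmetric])
  also have "\<dots> = (norm v)\<^sup>2 * (norm h)\<^sup>2"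
    by (simp add: norm_vec_def[of h] L2_set_def sum_nonneg sum_distrib_left)
  finally show ?thesis by (simp add: mult.commute)
qed

context bit_probs
begin

abbreviation (input) bitset :: "nat \<Rightarrow> nat \<Rightarrow> nat set" where
  "bitset k u \<equiv> {i. i < 2 ^ m \<and> nbit i k = u}"

lemma PC_pos: "k < m \<Longrightarrow> PC q k u > 0"
  using q[of k] by (auto simp: PC_def)

lemma gauss_mixture_bit:
  assumes "k < m" "u = 0 \<or> u = 1"
  shows "gauss_mixture (bitset k u) (\<lambda>i. Psym m q i / PC q k u)"
proof
  show "0 \<le> Psym m q i / PC q k u" for i
    by (intro divide_nonneg_nonneg less_imp_le[OF PC_pos[OF assms(1)]] less_imp_le[OF Psym_pos[OF q]])
  show "(\<Sum>i\<in>bitset k u. Psym m q i / PC q k u) = 1"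
    using sum_Psym_nbit_eq[OF assms, of q] PC_pos[OF assms(1), of u] by (simp flip: sum_divide_distrib)
qed simp

lemma gauss_mixture_symbol: "gauss_mixture {..<2 ^ m} (Psym m q)"
  by unfold_locales (auto simp: sum_Psym intro: less_imp_le[OF Psym_pos[OF q]])

definition bitent :: "(nat \<Rightarrow> real ^ 'n) \<Rightarrow> nat \<Rightarrow> nat \<Rightarrow> real ^ 'n \<Rightarrow> real \<Rightarrow> real" where
  "bitent x k u h = gauss_mixture.mixent (bitset k u) (\<lambda>i. Psym m q i / PC q k u) (\<lambda>i. hprod h (x i))"

definition outent :: "(nat \<Rightarrow> real ^ 'n) \<Rightarrow> real ^ 'n \<Rightarrow> real \<Rightarrow> real" where
  "outent x h = gauss_mixture.mixent {..<2 ^ m} (Psym m q) (\<lambda>i. hprod h (x i))"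

lemma bitent_bounds:
  assumes "k < m" "u = 0 \<or> u = 1"
  shows "0 \<le> bitent x k u h t" "bitent x k u h t \<le> 2 * t\<^sup>2 * ((norm h)\<^sup>2 * (\<Sum>i<2 ^ m. (norm (x i))\<^sup>2))"
proof -
  interpret gauss_mixture "bitset k u" "\<lambda>i. Psym m q i / PC q k u" "\<lambda>i. hprod h (x i)"
    by (rule gauss_mixture_bit[OF assms])
  show "0 \<le> bitent x k u h t" unfolding bitent_def by (rule mixent_nonneg)
  show "bitent x k u h t \<le> 2 * t\<^sup>2 * ((norm h)\<^sup>2 * (\<Sum>i<2 ^ m. (norm (x i))\<^sup>2))"
    unfolding bitent_def
    by (rule mixent_le, rule order_trans[OF norm_hprod_le], intro mult_left_mono member_le_sum) auto
qed

lemma outent_bounds: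
  shows "0 \<le> outent x h t" "outent x h t \<le> 2 * t\<^sup>2 * ((norm h)\<^sup>2 * (\<Sum>i<2 ^ m. (norm (x i))\<^sup>2))"
proof -
  interpret gauss_mixture "{..<2 ^ m}" "Psym m q" "\<lambda>i. hprod h (x i)"
    by (rule gauss_mixture_symbol)
  show "0 \<le> outent x h t" unfolding outent_def by (rule mixent_nonneg)
  show "outent x h t \<le> 2 * t\<^sup>2 * ((norm h)\<^sup>2 * (\<Sum>i<2 ^ m. (norm (x i))\<^sup>2))"
    unfolding outent_def
    by (rule mixent_le, rule order_trans[OF norm_hprod_le], intro mult_left_mono member_le_sum) auto
qed

lemma bitent_tendsto:
  assumes "k < m" "u = 0 \<or> u = 1"
  shows "((\<lambda>s. s\<^sup>2 * bitent x k u h (1 / s)) \<longlongrightarrow> (norm (hprod h (bitmean m q x k u)))\<^sup>2) at_top"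
proof -
  interpret gauss_mixture "bitset k u" "\<lambda>i. Psym m q i / PC q k u" "\<lambda>i. hprod h (x i)"
    by (rule gauss_mixture_bit[OF assms])
  show ?thesis
    using mixent_tendsto unfolding bitent_def hprod_sum_scaleR bitmean_def .
qed

lemma outent_tendsto:
  "((\<lambda>s. s\<^sup>2 * outent x h (1 / s)) \<longlongrightarrow> (norm (hprod h (cmean m q x)))\<^sup>2) at_top"
proof -
  interpret gauss_mixture "{..<2 ^ m}" "Psym m q" "\<lambda>i. hprod h (x i)"
    by (rule gauss_mixture_symbol)
  show ?thesis
    using mixent_tendsto unfolding outent_def hprod_sum_scaleR cmean_def .
qed

lemma MIbit_eq:
  fixes x :: "nat \<Rightarrow> real ^ 'n"
  assumes k: "k < m" and s: "s > 0"
  shows "MIbit m q x (s\<^sup>2) k h =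
    (q k * bitent x k 0 h (1 / s) + (1 - q k) * bitent x k 1 h (1 / s) - outent x h (1 / s)) / ln 2"
proof -
  let ?t = "1 / s" and ?G = "gauss 1 (0::real ^ 'n)"
  define f where "f u = gauss_mixture.mix (bitset k u) (\<lambda>i. Psym m q i / PC q k u) (\<lambda>i. hprod h (x i)) ?t" for u
  interpret out: gauss_mixture "{..<2 ^ m}" "Psym m q" "\<lambda>i. hprod h (x i)"
    by (rule gauss_mixture_symbol)
  define g where "g = out.mix ?t"
  have bit_mixture: "gauss_mixture (bitset k u) (\<lambda>i. Psym m q i / PC q k u)" if "u = 0 \<or> u = 1" for u
    using gauss_mixture_bit[OF k that] .
  have fpos: "f u z > 0" if "u = 0 \<or> u = 1" for u z
    unfolding f_def by (rule gauss_mixture.mix_pos[OF bit_mixture[OF that]])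
  have fmeas[measurable]: "f u \<in> borel_measurable borel" if "u = 0 \<or> u = 1" for u
    unfolding f_def by (rule gauss_mixture.borel_measurable_mix[OF bit_mixture[OF that]])
  have gpos: "g z > 0" for z unfolding g_def by (rule out.mix_pos)
  have gmeas[measurable]: "g \<in> borel_measurable borel" unfolding g_def by measurable
  have g_eq: "g z = q k * f 0 z + (1 - q k) * f 1 z" for z
    unfolding g_def f_def out.mix_def gauss_mixture.mix_def[OF bit_mixture[OF disjI1[OF refl]]]
      gauss_mixture.mix_def[OF bit_mixture[OF disjI2[OF refl]]]
    using q[OF k] by (simp add: sum_split_nbit[of _ m k] sum_distrib_left PC_def)
  have scale: "s ^ CARD('n) * (w * gauss (s\<^sup>2) c (s *\<^sub>R z)) = ?G z * (w * tilt ?t c z)" for w z and c :: "real ^ 'n"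
    using gauss_scale[OF s, of c z] by (metis mult.left_commute)
  have pbit_eq: "s ^ CARD('n) * pbit m q x (s\<^sup>2) k u h (s *\<^sub>R z) = ?G z * f u z" if "u = 0 \<or> u = 1" for u z
    unfolding f_def pbit_def gauss_mixture.mix_def[OF bit_mixture[OF that]] sum_distrib_left
    by (simp only: scale)
  have pout_eq: "s ^ CARD('n) * pout m q x (s\<^sup>2) h (s *\<^sub>R z) = ?G z * g z" for z
    unfolding g_def pout_def out.mix_def sum_distrib_left
    by (simp only: scale)
  have int_g: "has_bochner_integral lborel (\<lambda>z. ?G z * (g z * ln (g z))) (outent x h ?t)"
    unfolding g_def outent_def by (rule out.has_bochner_integral_mix_ln)
  have int_f: "has_bochner_integral lborel (\<lambda>z. ?G z * (f u z * ln (f u z))) (bitent x k u h ?t)"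
    if "u = 0 \<or> u = 1" for u
    unfolding f_def bitent_def by (rule gauss_mixture.has_bochner_integral_mix_ln[OF bit_mixture[OF that]])
  have int_fg: "integrable lborel (\<lambda>z. ?G z * (f u z * ln (g z)))" if u: "u = 0 \<or> u = 1" for u
  proof (rule Bochner_Integration.integrable_bound)
    show "integrable lborel (\<lambda>z. (?G z * (g z * ln (g z))) / PC q k u)"
      using int_g by (auto simp: has_bochner_integral_iff)
    show "AE z in lborel. norm (?G z * (f u z * ln (g z))) \<le> norm (?G z * (g z * ln (g z)) / PC q k u)"
    proof (rule AE_I2)
      fix z
      have "PC q k u * f u z \<le> g z"
        unfolding g_eq using u fpos[of 0 z] fpos[of 1 z] q[OF k] by (auto simp: PC_def)
      then have "f u z \<le> g z / PC q k u" using PC_pos[OF k, of u] by (simp add: field_simps)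
      then have "?G z * (f u z * \<bar>ln (g z)\<bar>) \<le> ?G z * (g z / PC q k u * \<bar>ln (g z)\<bar>)"
        by (intro mult_left_mono mult_right_mono) auto
      then show "norm (?G z * (f u z * ln (g z))) \<le> norm (?G z * (g z * ln (g z)) / PC q k u)"
        using fpos[OF u, of z] gpos[of z] PC_pos[OF k, of u] by (simp add: abs_mult)
    qed
  qed (use u in measurable)
  define K where "K u = (\<integral>z. ?G z * (f u z * ln (g z)) \<partial>lborel)" for u
  have bit: "(\<integral>y. pbit m q x (s\<^sup>2) k u h y * log 2 (pbit m q x (s\<^sup>2) k u h y / pout m q x (s\<^sup>2) h y) \<partial>lborel)
      = (bitent x k u h ?t - K u) / ln 2" if u: "u = 0 \<or> u = 1" for u
  proof -
    have "(\<integral>y. pbit m q x (s\<^sup>2) k u h y * log 2 (pbit m q x (s\<^sup>2) k u h y / pout m q x (s\<^sup>2) h y) \<partial>lborel)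
       = (\<integral>z. s ^ CARD('n) * (pbit m q x (s\<^sup>2) k u h (s *\<^sub>R z) * log 2 (pbit m q x (s\<^sup>2) k u h (s *\<^sub>R z) / pout m q x (s\<^sup>2) h (s *\<^sub>R z))) \<partial>lborel)"
      by (subst lborel_integral_scaleR[OF _ s]) (auto simp: pbit_def pout_def)
    also have "\<dots> = (\<integral>z. (?G z * (f u z * ln (f u z)) - ?G z * (f u z * ln (g z))) / ln 2 \<partial>lborel)"
    proof (intro Bochner_Integration.integral_cong refl)
      fix z
      let ?n = "s ^ CARD('n)"
      let ?p = "pbit m q x (s\<^sup>2) k u h (s *\<^sub>R z)" and ?o = "pout m q x (s\<^sup>2) h (s *\<^sub>R z)"
      have "?p / ?o = (?n * ?p) / (?n * ?o)" using s by simp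
      also have "\<dots> = f u z / g z"
        unfolding pbit_eq[OF u] pout_eq using gauss_pos[of 1 "0::real ^ 'n" z] by simp
      finally have r: "?p / ?o = f u z / g z" .
      have "?n * (?p * log 2 (?p / ?o)) = (?n * ?p) * log 2 (?p / ?o)" by simp
      also have "\<dots> = ?G z * f u z * log 2 (f u z / g z)" unfolding pbit_eq[OF u] r ..
      also have "\<dots> = (?G z * (f u z * ln (f u z)) - ?G z * (f u z * ln (g z))) / ln 2"
        using fpos[OF u, of z] gpos[of z] by (simp add: log_def ln_div field_simps)
      finally show "?n * (?p * log 2 (?p / ?o)) = (?G z * (f u z * ln (f u z)) - ?G z * (f u z * ln (g z))) / ln 2" .
    qed
    also have "\<dots> = (bitent x k u h ?t - K u) / ln 2"
      unfolding K_def has_bochner_integral_integral_eq[OF int_f[OF u], symmetric]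
      using int_f[OF u] int_fg[OF u] by (subst Bochner_Integration.integral_divide_zero, subst Bochner_Integration.integral_diff)
        (auto simp: has_bochner_integral_iff)
    finally show ?thesis .
  qed
  have "q k * K 0 + (1 - q k) * K 1 = (\<integral>z. q k * (?G z * (f 0 z * ln (g z))) + (1 - q k) * (?G z * (f 1 z * ln (g z))) \<partial>lborel)"
    unfolding K_def using int_fg[of 0] int_fg[of 1] by simp
  also have "\<dots> = (\<integral>z. ?G z * (g z * ln (g z)) \<partial>lborel)"
    by (intro Bochner_Integration.integral_cong refl) (simp add: g_eq algebra_simps)
  also have "\<dots> = outent x h ?t"
    by (rule has_bochner_integral_integral_eq[OF int_g])
  finally have K: "q k * K 0 + (1 - q k) * K 1 = outent x h ?t" .
  have "MIbit m q x (s\<^sup>2) k h = q k * ((bitent x k 0 h ?t - K 0) / ln 2) + (1 - q k) * ((bitent x k 1 h ?t - K 1) / ln 2)"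
    unfolding MIbit_def using bit[of 0] bit[of 1] by (simp add: PC_def)
  also have "\<dots> = (q k * bitent x k 0 h ?t + (1 - q k) * bitent x k 1 h ?t - (q k * K 0 + (1 - q k) * K 1)) / ln 2"
    by (simp add: field_simps)
  finally show ?thesis unfolding K .
qed

lemma MIbit_bound:
  assumes k: "k < m" and s: "s > 0"
  shows "\<bar>s\<^sup>2 * MIbit m q x (s\<^sup>2) k h\<bar> \<le> 4 / ln 2 * (\<Sum>i<2 ^ m. (norm (x i))\<^sup>2) * (norm h)\<^sup>2"
proof -
  let ?B = "(norm h)\<^sup>2 * (\<Sum>i<2 ^ m. (norm (x i))\<^sup>2)" and ?C = "2 * (1 / s)\<^sup>2 * ((norm h)\<^sup>2 * (\<Sum>i<2 ^ m. (norm (x i))\<^sup>2))"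
  let ?a = "q k * bitent x k 0 h (1 / s) + (1 - q k) * bitent x k 1 h (1 / s)" and ?b = "outent x h (1 / s)"
  have "?a \<ge> 0" using q[OF k] by (intro add_nonneg_nonneg mult_nonneg_nonneg bitent_bounds(1)[OF k]) auto
  moreover have "?a \<le> q k * ?C + (1 - q k) * ?C"
    using q[OF k] bitent_bounds(2)[OF k] by (intro add_mono mult_left_mono) auto
  then have "?a \<le> ?C" by (simp add: algebra_simps)
  moreover have "0 \<le> ?b" "?b \<le> ?C" by (rule outent_bounds)+
  ultimately have "\<bar>?a - ?b\<bar> \<le> 2 * ?C" by linarith
  then have "s\<^sup>2 * \<bar>?a - ?b\<bar> / ln 2 \<le> s\<^sup>2 * (2 * ?C) / ln 2"
    by (intro divide_right_mono mult_left_mono) auto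
  also have "\<dots> = 4 / ln 2 * (\<Sum>i<2 ^ m. (norm (x i))\<^sup>2) * (norm h)\<^sup>2"
    using s by (simp add: field_simps)
  finally show ?thesis
    unfolding MIbit_eq[OF k s] by (simp add: abs_mult)
qed

lemma MIbit_tendsto:
  assumes k: "k < m"
  shows "((\<lambda>s. s\<^sup>2 * MIbit m q x (s\<^sup>2) k h) \<longlongrightarrow>
    (q k * (norm (hprod h (bitmean m q x k 0)))\<^sup>2 + (1 - q k) * (norm (hprod h (bitmean m q x k 1)))\<^sup>2
      - (norm (hprod h (cmean m q x)))\<^sup>2) / ln 2) at_top"
proof -
  have "((\<lambda>s. (q k * (s\<^sup>2 * bitent x k 0 h (1 / s)) + (1 - q k) * (s\<^sup>2 * bitent x k 1 h (1 / s))
      - s\<^sup>2 * outent x h (1 / s)) / ln 2) \<longlongrightarrow>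
    (q k * (norm (hprod h (bitmean m q x k 0)))\<^sup>2 + (1 - q k) * (norm (hprod h (bitmean m q x k 1)))\<^sup>2
      - (norm (hprod h (cmean m q x)))\<^sup>2) / ln 2) at_top"
    by (intro tendsto_intros bitent_tendsto outent_tendsto k) auto
  moreover have "\<forall>\<^sub>F s in at_top. (q k * (s\<^sup>2 * bitent x k 0 h (1 / s)) + (1 - q k) * (s\<^sup>2 * bitent x k 1 h (1 / s))
      - s\<^sup>2 * outent x h (1 / s)) / ln 2 = s\<^sup>2 * MIbit m q x (s\<^sup>2) k h"
    using eventually_gt_at_top[of 0] by eventually_elim (simp add: MIbit_eq k algebra_simps)
  ultimately show ?thesis by (rule Lim_transform_eventually)
qed

end

lemma borel_measurable_MIbit [measurable]: "MIbit m q x N0 k \<in> borel_measurable borel"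
proof -
  have [measurable]: "(\<lambda>p::(real ^ 'n) \<times> (real ^ 'n). gauss N0 (hprod (fst p) v) (snd p)) \<in> borel_measurable (borel \<Otimes>\<^sub>M borel)" for v
    unfolding gauss_def hprod_def by simp measurable
  show ?thesis
    unfolding MIbit_def pbit_def pout_def by measurable
qed

lemma borel_measurable_pdf:
  fixes p :: "real \<Rightarrow> real"
  assumes "(\<lambda>t. t\<^sup>2 * p t) \<in> borel_measurable borel"
  shows "p \<in> borel_measurable borel"
proof -
  have "(\<lambda>t. if t = 0 then p 0 else (t\<^sup>2 * p t) / t\<^sup>2) \<in> borel_measurable borel"
    using assms by measurable
  moreover have "(\<lambda>t. if t = 0 then p 0 else (t\<^sup>2 * p t) / t\<^sup>2) = p" by auto
  ultimately show ?thesis by simp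
qed

locale fading =
  fixes PH :: "(real ^ 'n) measure" and pH :: "real \<Rightarrow> real"
  assumes PH_prob: "prob_space PH" and PH_sets: "sets PH = sets borel"
    and marg: "\<And>a. distr PH lborel (\<lambda>h. h $ a) = density lborel (\<lambda>t. ennreal (pH t))"
    and pH_nonneg: "\<And>t. pH t \<ge> 0"
    and EH2_fin: "integrable lborel (\<lambda>t. t\<^sup>2 * pH t)"
begin

lemma pH_measurable [measurable]: "pH \<in> borel_measurable borel"
  using borel_measurable_integrable[OF EH2_fin] by (simp add: borel_measurable_pdf)

lemma measurable_PH: "f \<in> measurable borel M \<Longrightarrow> f \<in> measurable PH M"
  using measurable_cong_sets[OF PH_sets refl] by blast

lemma component_square:
  shows "integrable PH (\<lambda>h. (h $ a)\<^sup>2)" and "(\<integral>h. (h $ a)\<^sup>2 \<partial>PH) = EH2 pH"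
proof -
  have m: "(\<lambda>h. h $ a) \<in> measurable PH lborel" by (intro measurable_PH) simp
  have "integrable (density lborel (\<lambda>t. ennreal (pH t))) (\<lambda>t. t\<^sup>2)"
    using EH2_fin pH_nonneg by (subst integrable_density) (auto simp: mult.commute)
  then have "integrable (distr PH lborel (\<lambda>h. h $ a)) (\<lambda>t. t\<^sup>2)" unfolding marg .
  then show "integrable PH (\<lambda>h. (h $ a)\<^sup>2)" using m by (subst (asm) integrable_distr_eq) auto
  have "(\<integral>h. (h $ a)\<^sup>2 \<partial>PH) = (\<integral>t. t\<^sup>2 \<partial>distr PH lborel (\<lambda>h. h $ a))"
    using m by (subst integral_distr) auto
  also have "\<dots> = EH2 pH"
    unfolding marg EH2_def using pH_nonneg by (subst integral_density) (auto simp: mult.commute)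
  finally show "(\<integral>h. (h $ a)\<^sup>2 \<partial>PH) = EH2 pH" .
qed

lemma norm_hprod_square_integral:
  shows "integrable PH (\<lambda>h. (norm (hprod h v))\<^sup>2)"
    and "(\<integral>h. (norm (hprod h v))\<^sup>2 \<partial>PH) = EH2 pH * (norm v)\<^sup>2"
proof -
  show "integrable PH (\<lambda>h. (norm (hprod h v))\<^sup>2)"
    unfolding norm_hprod_square by (intro Bochner_Integration.integrable_sum integrable_mult_right component_square)
  have "(\<integral>h. (norm (hprod h v))\<^sup>2 \<partial>PH) = (\<Sum>a\<in>UNIV. (v $ a)\<^sup>2 * EH2 pH)"
    unfolding norm_hprod_square by (subst Bochner_Integration.integral_sum) (auto simp: component_square)
  also have "\<dots> = EH2 pH * (norm v)\<^sup>2"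
    by (simp add: norm_vec_def L2_set_def sum_nonneg sum_distrib_left mult.commute)
  finally show "(\<integral>h. (norm (hprod h v))\<^sup>2 \<partial>PH) = EH2 pH * (norm v)\<^sup>2" .
qed

lemma norm_square_integrable: "integrable PH (\<lambda>h. (norm h)\<^sup>2)"
proof -
  have "hprod h (\<chi> a. 1) = h" for h :: "real ^ 'n" by (simp add: hprod_def vec_eq_iff)
  then show ?thesis using norm_hprod_square_integral(1)[of "\<chi> a. 1"] by simp
qed

lemma EH2_pos: "EH2 pH > 0"
proof (rule ccontr)
  assume "\<not> EH2 pH > 0"
  moreover have "EH2 pH \<ge> 0" unfolding EH2_def using pH_nonneg by (intro Bochner_Integration.integral_nonneg) auto
  ultimately have "(\<integral>t. t\<^sup>2 * pH t \<partial>lborel) = 0" by (simp add: EH2_def)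
  then have "AE t in lborel. t\<^sup>2 * pH t = 0"
    using integral_nonneg_eq_0_iff_AE[OF EH2_fin] pH_nonneg by simp
  then have "AE t in lborel. ennreal (pH t) = 0"
    using AE_lborel_singleton[of "0::real"] by eventually_elim auto
  then have "emeasure (density lborel (\<lambda>t. ennreal (pH t))) UNIV = 0"
    by (subst emeasure_density) (auto simp: nn_integral_0_iff_AE)
  moreover have "emeasure (distr PH lborel (\<lambda>h. h $ a)) UNIV = 1" for a
  proof -
    have m: "(\<lambda>h. h $ a) \<in> measurable PH lborel" by (intro measurable_PH) simp
    then show ?thesis
      using prob_space.emeasure_space_1[OF PH_prob] by (subst emeasure_distr) auto
  qed
  ultimately show False unfolding marg by simp
qed

end

locale bicm = bit_probs m q + fading PH pH
  for m :: nat and q :: "nat \<Rightarrow> real" and PH :: "(real ^ 'n) measure" and pH :: "real \<Rightarrow> real"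
begin

lemma MIbit_integral_tendsto:
  assumes k: "k < m"
  shows "((\<lambda>s. \<integral>h. s\<^sup>2 * MIbit m q x (s\<^sup>2) k h \<partial>PH) \<longlongrightarrow>
    EH2 pH * (q k * (1 - q k) * (norm (bitdiff x k))\<^sup>2) / ln 2) at_top"
proof -
  let ?f = "\<lambda>h. (q k * (norm (hprod h (bitmean m q x k 0)))\<^sup>2 + (1 - q k) * (norm (hprod h (bitmean m q x k 1)))\<^sup>2
      - (norm (hprod h (cmean m q x)))\<^sup>2) / ln 2"
  let ?D = "\<lambda>h::real ^ 'n. 4 / ln 2 * (\<Sum>i<2 ^ m. (norm (x i))\<^sup>2) * (norm h)\<^sup>2"
  have int: "integrable PH ?f"
    by (intro integrable_divide Bochner_Integration.integrable_diff Bochner_Integration.integrable_add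
        integrable_mult_right norm_hprod_square_integral)
  have D: "integrable PH ?D" by (intro integrable_mult_right norm_square_integrable)
  have "((\<lambda>s. \<integral>h. s\<^sup>2 * MIbit m q x (s\<^sup>2) k h \<partial>PH) \<longlongrightarrow> (\<integral>h. ?f h \<partial>PH)) at_top"
  proof (rule integral_dominated_convergence_at_top[OF _ _ D])
    show "?f \<in> borel_measurable PH" using int by (rule borel_measurable_integrable)
    show "(\<lambda>h. s\<^sup>2 * MIbit m q x (s\<^sup>2) k h) \<in> borel_measurable PH" for s
      by (intro measurable_PH) measurable
    show "AE h in PH. ((\<lambda>s. s\<^sup>2 * MIbit m q x (s\<^sup>2) k h) \<longlongrightarrow> ?f h) at_top"
      by (intro AE_I2 MIbit_tendsto k)
    show "\<forall>\<^sub>F s in at_top. AE h in PH. norm (s\<^sup>2 * MIbit m q x (s\<^sup>2) k h) \<le> ?D h"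
      using eventually_gt_at_top[of 0]
      by eventually_elim (use MIbit_bound[OF k] in \<open>auto intro!: AE_I2\<close>)
  qed
  moreover have "(\<integral>h. ?f h \<partial>PH) = EH2 pH * (q k * (norm (bitmean m q x k 0))\<^sup>2
      + (1 - q k) * (norm (bitmean m q x k 1))\<^sup>2 - (norm (cmean m q x))\<^sup>2) / ln 2"
    by (simp add: norm_hprod_square_integral algebra_simps)
  ultimately show ?thesis unfolding bit_variance[OF k] by simp
qed

lemma gmi_slope:
  assumes Es_pos: "Es m q x > 0"
  shows "((\<lambda>y. gmi m q x PH pH y / y) \<longlongrightarrow>
    (\<Sum>k<m. q k * (1 - q k) * (norm (bitdiff x k))\<^sup>2) / (Es m q x * ln 2)) (at_right 0)"
proof -
  let ?K = "EH2 pH * Es m q x"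
  let ?V = "\<lambda>k. q k * (1 - q k) * (norm (bitdiff x k))\<^sup>2"
  let ?F = "\<lambda>s. (\<Sum>k<m. \<integral>h. s\<^sup>2 * MIbit m q x (s\<^sup>2) k h \<partial>PH) / ?K"
  have K: "?K > 0" using EH2_pos Es_pos by simp
  have "(?F \<longlongrightarrow> (\<Sum>k<m. EH2 pH * ?V k / ln 2) / ?K) at_top"
    using K by (intro tendsto_intros MIbit_integral_tendsto) auto
  moreover have "filterlim (\<lambda>y. sqrt (?K / y)) at_top (at_right 0)"
  proof -
    have "filterlim (\<lambda>y. sqrt (c / y)) at_top (at_right 0)" if "c > 0" for c :: real
      using that by real_asymp
    then show ?thesis using K by blast
  qed
  ultimately have "((\<lambda>y. ?F (sqrt (?K / y))) \<longlongrightarrow> (\<Sum>k<m. EH2 pH * ?V k / ln 2) / ?K) (at_right 0)"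
    by (rule filterlim_compose)
  moreover have "(\<Sum>k<m. EH2 pH * ?V k / ln 2) / ?K = (\<Sum>k<m. ?V k) / (Es m q x * ln 2)"
    using EH2_pos by (simp add: sum_distrib_left[symmetric] sum_divide_distrib[symmetric])
  moreover have "\<forall>\<^sub>F y in at_right 0. ?F (sqrt (?K / y)) = gmi m q x PH pH y / y"
    using eventually_at_right_less[of 0]
  proof eventually_elim
    case (elim y)
    then have s: "(sqrt (?K / y))\<^sup>2 = ?K / y" using K by simp
    have "(\<Sum>k<m. \<integral>h. ?K / y * MIbit m q x (?K / y) k h \<partial>PH) = ?K / y * (\<Sum>k<m. \<integral>h. MIbit m q x (?K / y) k h \<partial>PH)"
      by (simp add: sum_distrib_left)
    then show ?case
      unfolding s gmi_def Let_def using elim EH2_pos Es_pos by simp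
  qed
  ultimately show ?thesis by (simp add: tendsto_cong)
qed

end

theorem theorem9:
  fixes m :: nat and q :: "nat \<Rightarrow> real" and x :: "nat \<Rightarrow> real ^ 'n"
    and PH :: "(real ^ 'n) measure" and pH :: "real \<Rightarrow> real"
  assumes m: "m \<ge> 1"
    and q: "\<And>k. k < m \<Longrightarrow> 0 < q k \<and> q k < 1"
    and PH_prob: "prob_space PH" and PH_sets: "sets PH = sets borel"
    and marg: "\<And>a. distr PH lborel (\<lambda>h. h $ a) = density lborel (\<lambda>t. ennreal (pH t))"
    and pH_nonneg: "\<And>t. pH t \<ge> 0"
    and EH2_fin: "integrable lborel (\<lambda>t. t\<^sup>2 * pH t)"
    and Es_pos: "Es m q x > 0"
  shows "FOO m q x PH pH \<longleftrightarrow>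
           (cmean m q x = 0 \<and>
            (\<forall>j<2 ^ m. j \<noteq> 0 \<and> (\<forall>k<m. j \<noteq> 2 ^ k) \<longrightarrow> hadamard m x j = 0))"
proof -
  interpret bicm m q PH pH
    by (intro bicm.intro bit_probs.intro fading.intro assms)
  let ?A = "\<Sum>k<m. q k * (1 - q k) * (norm (bitdiff x k))\<^sup>2"
  have "FOO m q x PH pH \<longleftrightarrow> ((\<lambda>y. gmi m q x PH pH y / y) \<longlongrightarrow> 1 / ln 2) (at_right 0)"
    unfolding FOO_def has_field_derivative_iff by (simp add: gmi_def[of _ _ _ _ _ 0] log_def)
  also have "\<dots> \<longleftrightarrow> ?A / (Es m q x * ln 2) = 1 / ln 2"
  proof
    assume "((\<lambda>y. gmi m q x PH pH y / y) \<longlongrightarrow> 1 / ln 2) (at_right 0)"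
    then show "?A / (Es m q x * ln 2) = 1 / ln 2"
      by (rule tendsto_unique[OF trivial_limit_at_right_real gmi_slope[OF Es_pos]])
  next
    assume eq: "?A / (Es m q x * ln 2) = 1 / ln 2"
    show "((\<lambda>y. gmi m q x PH pH y / y) \<longlongrightarrow> 1 / ln 2) (at_right 0)"
      using gmi_slope[OF Es_pos] unfolding eq .
  qed
  also have "\<dots> \<longleftrightarrow> Es m q x = ?A"
    using Es_pos by (auto simp: field_simps)
  finally show ?thesis unfolding Es_eq_bit_variance_iff .
qed

end
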